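(* Let $(X,Y)$ be a pair of real-valued random variables with distribution $R$ on $\mathbb{R}\times\mathbb{R}$, let $P$ be the distribution of $X$, and let $\mathcal{X}$ be the range of $X$. The following three conditions are equivalent: (i) For arbitrary Borel sets $A_1,A_2,B_1,B_2\subset\mathbb{R}$ with $A_1<A_2$ and $B_1<B_2$, \[ R(A_1\times B_2)\,R(A_2\times B_1)\ \le\ R(A_1\times B_1)\,R(A_2\times B_2). \qquad ( * ) \] (ii) There exists a dense subset $D$ of $\mathbb{R}$ such that for arbitrary numbers $x_0<x_1<x_2$ and $y_0<y_1<y_2$ in $D$, $( * )$ holds true with $A_1=(x_0,x_1]$, $A_2=(x_1,x_2]$ and $B_1=(y_0,y_1]$, $B_2=(y_1,y_2]$. (iii) There exists a stochastic kernel $K$ describing the conditional distribution of $Y$ given $X$ such that $K(x_1,\cdot)\le_{\rm lr}K(x_2,\cdot)$ for arbitrary $x_1,x_2\in\mathcal{X}$ with $x_1<x_2$.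
   Context: $\mathcal{B}$ is the Borel $\sigma$-field on $\mathbb{R}$. For sets, $A_1<A_2$ means $a_1<a_2$ for all $a_1\in A_1,a_2\in A_2$. Range of $X$: $\mathcal{X}:=\{x\in\mathbb{R}:\mathbb{P}(X\le x)>0\text{ and }\mathbb{P}(X\ge x)>0\}$. A stochastic kernel describing the conditional distribution of $Y$ given $X$ is a map $K:\mathbb{R}\times\mathcal{B}\to[0,1]$ such that $K(x,\cdot)$ is a probability measure for every $x\in\mathbb{R}$, $K(\cdot,B)$ is measurable for every $B\in\mathcal{B}$, and $R(A\times B)=\int_A K(x,B)\,P(\mathrm{d}x)$ for all $A,B\in\mathcal{B}$. Likelihood ratio order: $Q_1\le_{\rm lr}Q_2$ means that there exist a $\sigma$-finite measure $\mu$ on $\mathbb{R}$ and densities $g_j=\mathrm{d}Q_j/\mathrm{d}\mu:\mathbb{R}\to[0,\infty)$ ($j=1,2$) such that $g_2/g_1$ (with values in $[0,\infty]$, $c/0:=\infty$ for $c>0$) is non-decreasing on $\{g_1+g_2>0\}$. *)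

theory Defs
  imports "HOL-Probability.Probability"
begin

definition set_less :: "real set \<Rightarrow> real set \<Rightarrow> bool" where
  "set_less A1 A2 \<longleftrightarrow> (\<forall>a1\<in>A1. \<forall>a2\<in>A2. a1 < a2)"

definition joint_law :: "'a measure \<Rightarrow> ('a \<Rightarrow> real) \<Rightarrow> ('a \<Rightarrow> real) \<Rightarrow> (real \<times> real) measure" where
  "joint_law M X Y = distr M (borel \<Otimes>\<^sub>M borel) (\<lambda>\<omega>. (X \<omega>, Y \<omega>))"

definition rv_range :: "'a measure \<Rightarrow> ('a \<Rightarrow> real) \<Rightarrow> real set" where
  "rv_range M X = {x. \<P>(\<omega> in M. X \<omega> \<le> x) > 0 \<and> \<P>(\<omega> in M. X \<omega> \<ge> x) > 0}"

(* Membership in borel \<rightarrow>\<^sub>M prob_algebra borel says that every K x is a probability measure on the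
   Borel sets and that x \<mapsto> K x B is Borel measurable for every Borel set B; see the lemma below. *)
definition conditional_kernel ::
    "'a measure \<Rightarrow> ('a \<Rightarrow> real) \<Rightarrow> ('a \<Rightarrow> real) \<Rightarrow> (real \<Rightarrow> real measure) \<Rightarrow> bool" where
  "conditional_kernel M X Y K \<longleftrightarrow>
     K \<in> borel \<rightarrow>\<^sub>M prob_algebra borel \<and>
     (\<forall>A\<in>sets borel. \<forall>B\<in>sets borel.
        emeasure (joint_law M X Y) (A \<times> B) = (\<integral>\<^sup>+x\<in>A. emeasure (K x) B \<partial>distr M borel X))"

lemma kernel_iff:
  fixes K :: "real \<Rightarrow> real measure"
  shows "K \<in> borel \<rightarrow>\<^sub>M prob_algebra borel \<longleftrightarrow>
     (\<forall>x. prob_space (K x) \<and> sets (K x) = sets borel) \<and>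
     (\<forall>B\<in>sets borel. (\<lambda>x. measure (K x) B) \<in> borel_measurable borel)"
proof (intro iffI conjI allI ballI)
  assume K: "K \<in> borel \<rightarrow>\<^sub>M prob_algebra borel"
  show "prob_space (K x)" "sets (K x) = sets borel" for x
    using measurable_space[OF K, of x] by (auto simp: space_prob_algebra)
  show "(\<lambda>x. measure (K x) B) \<in> borel_measurable borel" if "B \<in> sets borel" for B
    using measurable_prob_algebraD[OF K] that by (intro measure_measurable_subprob_algebra2) auto
next
  assume *: "(\<forall>x. prob_space (K x) \<and> sets (K x) = sets borel) \<and>
     (\<forall>B\<in>sets borel. (\<lambda>x. measure (K x) B) \<in> borel_measurable borel)"
  have "emeasure (K x) B = ennreal (measure (K x) B)" for x B
    using * by (meson finite_measure.emeasure_eq_measure prob_space.finite_measure)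
  then have "K \<in> borel \<rightarrow>\<^sub>M subprob_algebra borel"
    using * by (intro measurable_subprob_algebra) (auto intro: prob_space_imp_subprob_space)
  with * show "K \<in> borel \<rightarrow>\<^sub>M prob_algebra borel"
    by (intro measurable_prob_algebraI) auto
qed

(* The quotient is taken in ennreal, where c / 0 = \<infinity> for c > 0; the junk value 0 / 0 = 0 does not
   occur on the set to which monotonicity is restricted. *)
definition lr_le :: "real measure \<Rightarrow> real measure \<Rightarrow> bool" (infix "\<le>\<^sub>l\<^sub>r" 50) where
  "Q1 \<le>\<^sub>l\<^sub>r Q2 \<longleftrightarrow>
     (\<exists>(\<mu> :: real measure) (g1 :: real \<Rightarrow> real) (g2 :: real \<Rightarrow> real).
        sigma_finite_measure \<mu> \<and> sets \<mu> = sets borel \<and>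
        g1 \<in> borel_measurable borel \<and> g2 \<in> borel_measurable borel \<and>
        (\<forall>x. 0 \<le> g1 x) \<and> (\<forall>x. 0 \<le> g2 x) \<and>
        Q1 = density \<mu> (\<lambda>x. ennreal (g1 x)) \<and> Q2 = density \<mu> (\<lambda>x. ennreal (g2 x)) \<and>
        mono_on {x. g1 x + g2 x > 0} (\<lambda>x. ennreal (g2 x) / ennreal (g1 x)))"

definition lr_ineq ::
    "(real \<times> real) measure \<Rightarrow> real set \<Rightarrow> real set \<Rightarrow> real set \<Rightarrow> real set \<Rightarrow> bool" where
  "lr_ineq R A1 A2 B1 B2 \<longleftrightarrow>
     measure R (A1 \<times> B2) * measure R (A2 \<times> B1) \<le> measure R (A1 \<times> B1) * measure R (A2 \<times> B2)"

end

theory Submission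
  imports Defs
begin

text \<open>
  For fixed sets in one coordinate, both sides of the inequality are measures in each of the two sets
  in the other coordinate, so it extends from intervals to separated Borel sets one slot at a time.

  If \<open>Q \<le> P\<close> and the ratio \<open>Q A / P A\<close> decreases when \<open>A\<close> moves to the right, then
  \<open>x \<mapsto> inf {Q A / P A | A \<subseteq> {..x}}\<close> is an antitone version of \<open>dQ/dP\<close>. With
  \<open>P = Q1 + Q2\<close> and \<open>Q = Q1\<close> this yields likelihood ratio order from the inequality. With the
  marginal law \<open>P\<close> of \<open>X\<close> and \<open>Q = R(\<cdot> \<times> {..y})\<close> it yields a conditional distribution
  function at every point of the range of \<open>X\<close>: an infimum of right-continuous nondecreasing functions
  of \<open>y\<close> is right-continuous, and mass on both sides of \<open>x\<close> makes the limits \<open>0\<close> and \<open>1\<close>. As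
  this infimum is a limit of ratios over shrinking intervals, the inequality passes to the kernel.
\<close>

section \<open>Comparing finite measures on half-open intervals\<close>

text \<open>Dominated convergence of the indicators. It also covers sequences that are not monotone,
  such as intervals both of whose endpoints move.\<close>

lemma (in finite_measure) tendsto_measure_eventually:
  assumes "\<And>n. S n \<in> sets M" "T \<in> sets M"
    and ev: "\<And>x. x \<in> space M \<Longrightarrow> eventually (\<lambda>n. x \<in> S n \<longleftrightarrow> x \<in> T) sequentially"
  shows "(\<lambda>n. measure M (S n)) \<longlonglongrightarrow> measure M T"
proof -
  have "(\<lambda>n. \<integral>x. indicator (S n) x \<partial>M) \<longlonglongrightarrow> (\<integral>x. indicator T x \<partial>M :: real)"
  proof (rule integral_dominated_convergence[where w="\<lambda>_. 1"])
    show "AE x in M. (\<lambda>n. indicator (S n) x :: real) \<longlonglongrightarrow> indicator T x"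
    proof (rule AE_I2)
      fix x assume "x \<in> space M"
      from ev[OF this] have "eventually (\<lambda>n. (indicator (S n) x :: real) = indicator T x) sequentially"
        by eventually_elim (auto simp: indicator_def)
      then show "(\<lambda>n. indicator (S n) x :: real) \<longlonglongrightarrow> indicator T x"
        by (rule tendsto_eventually)
    qed
  qed (use assms in \<open>auto simp: indicator_def\<close>)
  then show ?thesis
    using assms by (simp add: sets.Int_space_eq2)
qed

section \<open>Sums of two measures\<close>

definition sum_measure :: "'a measure \<Rightarrow> 'a measure \<Rightarrow> 'a measure" where
  "sum_measure M N = measure_of (space M) (sets M) (\<lambda>A. emeasure M A + emeasure N A)"

lemma sets_sum_measure [simp]: "sets (sum_measure M N) = sets M"
  and space_sum_measure [simp]: "space (sum_measure M N) = space M"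
  by (simp_all add: sum_measure_def)

lemma emeasure_sum_measure:
  assumes "sets N = sets M" "A \<in> sets M"
  shows "emeasure (sum_measure M N) A = emeasure M A + emeasure N A"
  unfolding sum_measure_def
proof (rule emeasure_measure_of_sigma)
  show "countably_additive (sets M) (\<lambda>A. emeasure M A + emeasure N A)"
  proof (rule countably_additiveI)
    fix F :: "nat \<Rightarrow> _" assume F: "range F \<subseteq> sets M" "disjoint_family F"
    show "(\<Sum>i. emeasure M (F i) + emeasure N (F i)) = emeasure M (\<Union>i. F i) + emeasure N (\<Union>i. F i)"
      using F assms by (subst suminf_add[symmetric]) (simp_all add: suminf_emeasure)
  qed
qed (use assms in \<open>auto simp: positive_def sets.sigma_algebra_axioms\<close>)

lemma finite_measure_sum_measure:
  assumes "finite_measure M" "finite_measure N" "sets N = sets M"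
  shows "finite_measure (sum_measure M N)"
proof
  interpret M: finite_measure M by fact
  interpret N: finite_measure N by fact
  show "emeasure (sum_measure M N) (space (sum_measure M N)) \<noteq> \<infinity>"
    using M.emeasure_finite N.emeasure_finite
    by (simp add: emeasure_sum_measure[OF assms(3)])
qed

lemma measure_sum_measure:
  assumes "finite_measure M" "finite_measure N" "sets N = sets M" "A \<in> sets M"
  shows "measure (sum_measure M N) A = measure M A + measure N A"
proof -
  interpret M: finite_measure M by fact
  interpret N: finite_measure N by fact
  interpret S: finite_measure "sum_measure M N"
    using assms by (intro finite_measure_sum_measure)
  have "ennreal (measure (sum_measure M N) A) = ennreal (measure M A + measure N A)"
    using assms by (simp add: S.emeasure_eq_measure[symmetric] emeasure_sum_measure
        M.emeasure_eq_measure N.emeasure_eq_measure ennreal_plus)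
  then show ?thesis by (subst (asm) ennreal_inj) auto
qed

text \<open>\<open>cdf N - cdf M\<close> is nondecreasing and right-continuous, hence the
  distribution function of a finite measure, and \<open>N\<close> is \<open>M\<close> plus that
  measure. A Dynkin argument on the inequality itself would fail, since inequalities do not pass to
  complements.\<close>

lemma measure_le_if_Ioc_le:
  assumes M: "finite_borel_measure M" and N: "finite_borel_measure N"
    and le: "\<And>a b. a < b \<Longrightarrow> measure M {a<..b} \<le> measure N {a<..b}"
    and B: "B \<in> sets borel"
  shows "measure M B \<le> measure N B"
proof -
  interpret M: finite_borel_measure M by fact
  interpret N: finite_borel_measure N by fact
  define F where "F x = cdf N x - cdf M x" for x
  have mono: "F x \<le> F y" if "x \<le> y" for x y
  proof (cases "x = y")
    case False
    then have "x < y" using that by simp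
    with le[OF this] show ?thesis
      unfolding F_def by (simp add: N.cdf_diff_eq[symmetric] M.cdf_diff_eq[symmetric])
  qed simp
  have rc: "continuous (at_right a) F" for a
    unfolding F_def by (intro continuous_intros M.cdf_is_right_cont N.cdf_is_right_cont)
  have bot: "(F \<longlongrightarrow> 0) at_bot"
    unfolding F_def using tendsto_diff[OF N.cdf_lim_at_bot M.cdf_lim_at_bot] by simp
  have top: "(F \<longlongrightarrow> measure N (space N) - measure M (space M)) at_top"
    unfolding F_def using tendsto_diff[OF N.cdf_lim_at_top M.cdf_lim_at_top] by simp
  have nonneg: "0 \<le> F x" for x
  proof (rule tendsto_upperbound[OF bot])
    show "\<forall>\<^sub>F y in at_bot. F y \<le> F x"
      using eventually_le_at_bot[of x] by eventually_elim (rule mono)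
  qed simp
  have m: "0 \<le> measure N (space N) - measure M (space M)"
    by (rule tendsto_lowerbound[OF top]) (auto simp: nonneg)
  interpret I: finite_borel_measure "interval_measure F"
    by (rule finite_borel_measure_interval_measure[OF mono rc bot top m])
  have cdfI: "cdf (interval_measure F) = F"
    by (rule cdf_interval_measure[OF mono rc bot])
  have sets: "sets (interval_measure F) = sets M" by (simp add: M.M_is_borel)
  have "N = sum_measure M (interval_measure F)"
  proof (rule cdf_unique'[OF N])
    show "finite_borel_measure (sum_measure M (interval_measure F))"
      by (intro finite_borel_measure.intro finite_measure_sum_measure finite_borel_measure_axioms.intro)
        (auto simp: M.M_is_borel M.finite_measure_axioms I.finite_measure_axioms)
    show "cdf N = cdf (sum_measure M (interval_measure F))"
    proof
      show "cdf N x = cdf (sum_measure M (interval_measure F)) x" for x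
        using fun_cong[OF cdfI, of x] M.M_is_borel
        by (simp add: cdf_def2 F_def measure_sum_measure[OF M.finite_measure_axioms I.finite_measure_axioms sets])
    qed
  qed
  then have "measure N B = measure M B + measure (interval_measure F) B"
    using measure_sum_measure[OF M.finite_measure_axioms I.finite_measure_axioms sets] B M.M_is_borel
    by simp
  then show ?thesis by simp
qed

lemma finite_borel_measure_scaled_restriction:
  assumes "finite_borel_measure M" "0 \<le> r" "S \<in> sets borel"
  obtains N where "finite_borel_measure N" "\<And>B. B \<in> sets borel \<Longrightarrow> measure N B = r * measure M (B \<inter> S)"
proof -
  interpret finite_borel_measure M by fact
  note M_is_borel[measurable_cong] assms(3)[measurable]
  define N where "N = density M (\<lambda>x. ennreal r * indicator S x)"
  have em: "emeasure N B = ennreal (r * measure M (B \<inter> S))" if "B \<in> sets borel" for B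
  proof -
    have "emeasure N B = (\<integral>\<^sup>+x. ennreal r * indicator (B \<inter> S) x \<partial>M)"
      unfolding N_def using that assms
      by (subst emeasure_density) (auto simp: indicator_inter_arith ac_simps M_is_borel intro!: nn_integral_cong)
    also have "\<dots> = ennreal r * emeasure M (B \<inter> S)"
      using that assms by (intro nn_integral_cmult_indicator) (auto simp: M_is_borel)
    finally show ?thesis
      using assms by (simp add: emeasure_eq_measure ennreal_mult)
  qed
  have sets: "sets N = sets borel"
    by (simp add: N_def M_is_borel)
  then have "emeasure N (space N) = ennreal (r * measure M (space N \<inter> S))"
    by (intro em) (metis sets.top)
  then have "finite_measure N"
    by (intro finite_measureI) simp
  with sets have "finite_borel_measure N"
    by (intro finite_borel_measure.intro finite_borel_measure_axioms.intro)
  moreover have "measure N B = r * measure M (B \<inter> S)" if "B \<in> sets borel" for B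
    using em[OF that] assms by (simp add: measure_def)
  ultimately show thesis by (rule that)
qed

text \<open>With one slot of the cross inequality held fixed, its values become the factors
  \<open>r\<close> and \<open>s\<close>, and \<open>S\<close> keeps the other slot on one side of a
  cut. Factor and restriction are absorbed into the measures, so the plain comparison
  applies.\<close>

lemma scaled_measure_le_if_Ioc_le:
  assumes M: "finite_borel_measure M" and N: "finite_borel_measure N"
    and r: "0 \<le> r" "0 \<le> s" and S: "S \<in> sets borel"
    and le: "\<And>a b. a < b \<Longrightarrow> r * measure M ({a<..b} \<inter> S) \<le> s * measure N ({a<..b} \<inter> S)"
    and B: "B \<in> sets borel"
  shows "r * measure M (B \<inter> S) \<le> s * measure N (B \<inter> S)"
proof -
  obtain M' where M': "finite_borel_measure M'" "\<And>B. B \<in> sets borel \<Longrightarrow> measure M' B = r * measure M (B \<inter> S)"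
    using finite_borel_measure_scaled_restriction[OF M r(1) S] by blast
  obtain N' where N': "finite_borel_measure N'" "\<And>B. B \<in> sets borel \<Longrightarrow> measure N' B = s * measure N (B \<inter> S)"
    using finite_borel_measure_scaled_restriction[OF N r(2) S] by blast
  have "measure M' B \<le> measure N' B"
    by (rule measure_le_if_Ioc_le[OF M'(1) N'(1) _ B]) (simp add: M'(2) N'(2) le)
  then show ?thesis by (simp add: M'(2) N'(2) B)
qed

section \<open>From adjacent intervals to separated Borel sets\<close>

lemma dense_approx_above:
  fixes D :: "real set"
  assumes "closure D = UNIV"
  obtains d where "\<And>n x. d n x \<in> D" "\<And>n x. x < d n x" "\<And>x. (\<lambda>n. d n x) \<longlonglongrightarrow> x"
proof -
  have "\<exists>y\<in>D. x < y \<and> y < x + 1 / real (Suc n)" for x n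
  proof -
    have "{x<..<x + 1 / real (Suc n)} \<inter> closure D \<noteq> {}"
      using assms by auto
    then have "{x<..<x + 1 / real (Suc n)} \<inter> D \<noteq> {}"
      by (simp only: open_Int_closure_eq_empty[OF open_greaterThanLessThan] not_False_eq_True)
    then show ?thesis by auto
  qed
  then have "\<forall>n x. \<exists>y. y \<in> D \<and> x < y \<and> y < x + 1 / real (Suc n)"
    by blast
  then obtain d where d: "\<And>n x. d n x \<in> D \<and> x < d n x \<and> d n x < x + 1 / real (Suc n)"
    unfolding choice_iff by blast
  have "(\<lambda>n. d n x) \<longlonglongrightarrow> x" for x
  proof (rule tendsto_sandwich)
    show "\<forall>\<^sub>F n in sequentially. x \<le> d n x" "\<forall>\<^sub>F n in sequentially. d n x \<le> x + 1 / real (Suc n)"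
      using d by (auto intro!: always_eventually less_imp_le)
    show "(\<lambda>n. x + 1 / real (Suc n)) \<longlonglongrightarrow> x"
      using tendsto_add[OF tendsto_const[of x] LIMSEQ_inverse_real_of_nat] by (simp add: inverse_eq_divide)
  qed simp
  with d show thesis by (intro that[of d]) auto
qed

text \<open>If the middle interval carries no mass at all, the two adjacent comparisons say nothing; only then is
  the comparison with the merged interval needed.\<close>

lemma cross_ineq_concat:
  fixes u1 u2 u3 v1 v2 v3 :: real
  assumes nn: "0 \<le> u1" "0 \<le> u2" "0 \<le> u3" "0 \<le> v1" "0 \<le> v2" "0 \<le> v3"
    and i: "v1 * u2 \<le> u1 * v2" "v2 * u3 \<le> u2 * v3" "v1 * (u2 + u3) \<le> u1 * (v2 + v3)"
  shows "v1 * u3 \<le> u1 * v3"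
proof -
  consider "u2 = 0" "v2 = 0" | "u2 = 0" "v2 > 0" | "u2 > 0" "v2 = 0" | "u2 > 0" "v2 > 0"
    using nn by linarith
  then show ?thesis
  proof cases
    case 2
    then have "v2 * u3 \<le> 0" using i(2) by simp
    with 2 have "u3 \<le> 0" by (simp add: mult_le_0_iff)
    with nn show ?thesis by simp
  next
    case 3
    then have "v1 * u2 \<le> 0" using i(1) by simp
    with 3 have "v1 \<le> 0" by (simp add: mult_le_0_iff)
    with nn show ?thesis by simp
  next
    case 4
    \<comment> \<open>The two adjacent comparisons are multiplied; the positive factor
      \<open>u2 * v2\<close> then cancels.\<close>
    have "(v1 * u2) * (v2 * u3) \<le> (u1 * v2) * (u2 * v3)"
      using i nn by (intro mult_mono[OF i(1,2)]) auto
    then have "(v1 * u3) * (u2 * v2) \<le> (u1 * v3) * (u2 * v2)"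
      by (simp add: ac_simps)
    with 4 show ?thesis by simp
  qed (use i in simp)
qed

text \<open>Approach from above is what fits half-open intervals: from below, the left endpoint
  would be picked up in the limit and the right endpoint lost.\<close>

lemma (in finite_borel_measure) measure_Ioc_tendsto:
  assumes "a \<longlonglongrightarrow> x" "b \<longlonglongrightarrow> y" "\<And>n::nat. x < a n" "\<And>n. y < b n"
  shows "(\<lambda>n. measure M {a n<..b n}) \<longlonglongrightarrow> measure M {x<..y}"
proof (rule tendsto_measure_eventually)
  fix z
  have 1: "\<forall>\<^sub>F n in sequentially. a n < z \<longleftrightarrow> x < z"
  proof (cases "x < z")
    case True
    with order_tendstoD(2)[OF assms(1) this] show ?thesis by (auto elim: eventually_mono)
  next
    case False
    then show ?thesis using assms(3) by (intro always_eventually) (metis less_trans)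
  qed
  have 2: "\<forall>\<^sub>F n in sequentially. z \<le> b n \<longleftrightarrow> z \<le> y"
  proof (cases "y < z")
    case True
    with order_tendstoD(2)[OF assms(2) this] show ?thesis by (auto elim: eventually_mono)
  next
    case False
    then have "z \<le> y" by simp
    with assms(4) have "z \<le> b n" for n by (meson le_less_trans less_imp_le)
    with \<open>z \<le> y\<close> show ?thesis by simp
  qed
  from 1 2 show "\<forall>\<^sub>F n in sequentially. z \<in> {a n<..b n} \<longleftrightarrow> z \<in> {x<..y}"
    by eventually_elim auto
qed (auto simp: M_is_borel)

text \<open>Limits from above along \<open>D\<close> give the inequality for all adjacent intervals.
  A gap \<open>{x1<..x2}\<close> is then treated as a middle interval and eliminated by
  \<open>cross_ineq_concat\<close>.\<close>

lemma cross_ineq_Ioc: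
  assumes M: "finite_borel_measure M" and N: "finite_borel_measure N"
    and D: "closure D = UNIV"
    and le: "\<And>x0 x1 x2. x0 \<in> D \<Longrightarrow> x1 \<in> D \<Longrightarrow> x2 \<in> D \<Longrightarrow> x0 < x1 \<Longrightarrow> x1 < x2 \<Longrightarrow>
      measure N {x0<..x1} * measure M {x1<..x2} \<le> measure M {x0<..x1} * measure N {x1<..x2}"
    and x: "x0 < x1" "x1 \<le> x2" "x2 < x3"
  shows "measure N {x0<..x1} * measure M {x2<..x3} \<le> measure M {x0<..x1} * measure N {x2<..x3}"
proof -
  interpret M: finite_borel_measure M by fact
  interpret N: finite_borel_measure N by fact
  obtain d where d: "\<And>n x. d n x \<in> D" "\<And>n x. x < d n x" "\<And>x. (\<lambda>n. d n x) \<longlonglongrightarrow> x"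
    using dense_approx_above[OF D] by blast
  have adj: "measure N {x<..y} * measure M {y<..z} \<le> measure M {x<..y} * measure N {y<..z}"
    if "x < y" "y < z" for x y z
  proof (rule tendsto_le[OF sequentially_bot])
    show "(\<lambda>n. measure N {d n x<..d n y} * measure M {d n y<..d n z}) \<longlonglongrightarrow> measure N {x<..y} * measure M {y<..z}"
      "(\<lambda>n. measure M {d n x<..d n y} * measure N {d n y<..d n z}) \<longlonglongrightarrow> measure M {x<..y} * measure N {y<..z}"
      by (intro tendsto_mult N.measure_Ioc_tendsto M.measure_Ioc_tendsto d(2,3))+
    have "\<forall>\<^sub>F n in sequentially. d n x < y" "\<forall>\<^sub>F n in sequentially. d n y < z"
      using order_tendstoD(2)[OF d(3)] that by auto
    then show "\<forall>\<^sub>F n in sequentially. measure N {d n x<..d n y} * measure M {d n y<..d n z}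
        \<le> measure M {d n x<..d n y} * measure N {d n y<..d n z}"
      proof eventually_elim
      case (elim n)
      have "d n x < d n y" "d n y < d n z"
        using elim d(2)[where x=y and n=n] d(2)[where x=z and n=n] by linarith+
      then show ?case by (intro le d(1))
    qed
  qed
  show ?thesis
  proof (cases "x1 = x2")
    case False
    with x have x': "x1 < x2" by simp
    have split: "measure L {x1<..x3} = measure L {x1<..x2} + measure L {x2<..x3}"
      if "finite_borel_measure L" for L
    proof -
      interpret L: finite_borel_measure L by fact
      show ?thesis
        using x x' by (simp add: L.cdf_diff_eq[symmetric])
    qed
    show ?thesis
      by (rule cross_ineq_concat[of _ "measure M {x1<..x2}" _ _ "measure N {x1<..x2}"])
        (use x x' adj[of x0 x1 x2] adj[of x1 x2 x3] adj[of x0 x1 x3] in \<open>simp_all add: split[OF M] split[OF N]\<close>)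
  qed (use adj x in simp)
qed

text \<open>The left set varies first, against a fixed interval right of \<open>c\<close>; then the
  right set varies against the fixed Borel set \<open>A\<close>. Clipped at \<open>c\<close>, a
  half-open interval stays half-open or becomes empty, so the inequality for intervals feeds each
  comparison.\<close>

lemma cross_ineq_borel_separated:
  assumes M: "finite_borel_measure M" and N: "finite_borel_measure N"
    and le: "\<And>x0 x1 x2 x3. x0 < x1 \<Longrightarrow> x1 \<le> x2 \<Longrightarrow> x2 < x3 \<Longrightarrow>
      measure N {x0<..x1} * measure M {x2<..x3} \<le> measure M {x0<..x1} * measure N {x2<..x3}"
    and A: "A \<in> sets borel" "A \<subseteq> {..c}" and B: "B \<in> sets borel" "B \<subseteq> {c<..}"
  shows "measure N A * measure M B \<le> measure M A * measure N B"
proof -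
  have 1: "measure M {a<..b} * measure N (A' \<inter> {..c}) \<le> measure N {a<..b} * measure M (A' \<inter> {..c})"
    if ab: "a < b" "c \<le> a" and A': "A' \<in> sets borel" for a b A'
  proof (rule scaled_measure_le_if_Ioc_le[OF N M _ _ _ _ A'])
    fix x y :: real assume "x < y"
    show "measure M {a<..b} * measure N ({x<..y} \<inter> {..c}) \<le> measure N {a<..b} * measure M ({x<..y} \<inter> {..c})"
    proof (cases "x < min y c")
      case True
      have "{x<..y} \<inter> {..c} = {x<..min y c}" by auto
      with le[OF True, of a b] ab show ?thesis by (simp add: mult.commute)
    next
      case False
      then have "{x<..y} \<inter> {..c} = {}" by auto
      then show ?thesis by simp
    qed
  qed auto
  have "measure N (A \<inter> {..c}) * measure M (B \<inter> {c<..}) \<le> measure M (A \<inter> {..c}) * measure N (B \<inter> {c<..})"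
  proof (rule scaled_measure_le_if_Ioc_le[OF M N _ _ _ _ B(1)])
    fix x y :: real assume "x < y"
    show "measure N (A \<inter> {..c}) * measure M ({x<..y} \<inter> {c<..}) \<le> measure M (A \<inter> {..c}) * measure N ({x<..y} \<inter> {c<..})"
    proof (cases "max x c < y")
      case True
      have "{x<..y} \<inter> {c<..} = {max x c<..y}" by auto
      with 1[OF True _ A(1)] show ?thesis by (simp add: mult.commute)
    next
      case False
      then have "{x<..y} \<inter> {c<..} = {}" by auto
      then show ?thesis by simp
    qed
  qed auto
  moreover have "A \<inter> {..c} = A" "B \<inter> {c<..} = B" using A B by auto
  ultimately show ?thesis by simp
qed

text \<open>\<open>Sup A\<close> serves as the cut: \<open>A\<close> lies in \<open>{..c}\<close>
  and \<open>B\<close> in \<open>{c..}\<close>. Only when the cut itself belongs to \<open>B\<close>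
  is a further limit taken.\<close>

lemma cross_ineq_borel:
  assumes M: "finite_borel_measure M" and N: "finite_borel_measure N"
    and D: "closure D = UNIV"
    and le: "\<And>x0 x1 x2. x0 \<in> D \<Longrightarrow> x1 \<in> D \<Longrightarrow> x2 \<in> D \<Longrightarrow> x0 < x1 \<Longrightarrow> x1 < x2 \<Longrightarrow>
      measure N {x0<..x1} * measure M {x1<..x2} \<le> measure M {x0<..x1} * measure N {x1<..x2}"
    and A: "A \<in> sets borel" and B: "B \<in> sets borel" and AB: "set_less A B"
  shows "measure N A * measure M B \<le> measure M A * measure N B"
proof (cases "A = {} \<or> B = {}")
  case False
  interpret M: finite_borel_measure M by fact
  interpret N: finite_borel_measure N by fact
  note sep = cross_ineq_borel_separated[OF M N cross_ineq_Ioc[OF M N D le]]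
  define c where "c = Sup A"
  have bdd: "bdd_above A" 
  proof -
    from False obtain b where "b \<in> B" by auto
    with AB show ?thesis by (intro bdd_aboveI[of _ b]) (auto simp: set_less_def intro: less_imp_le)
  qed
  have Ac: "A \<subseteq> {..c}" using bdd by (auto simp: c_def intro: cSup_upper)
  have cB: "B \<subseteq> {c..}" 
  proof
    fix b assume "b \<in> B"
    with False AB have "Sup A \<le> b" by (intro cSup_least) (auto simp: set_less_def intro: less_imp_le)
    then show "b \<in> {c..}" by (simp add: c_def)
  qed
  show ?thesis
  proof (cases "c \<in> B")
    case False
    with cB have "B \<subseteq> {c<..}" by (auto simp: less_le)
    with sep A B Ac show ?thesis by blast
  next
    case True
    then have Ac': "A \<subseteq> {..<c}" using AB by (auto simp: set_less_def)
    \<comment> \<open>Here \<open>c\<close> lies in \<open>B\<close>, hence not in \<open>A\<close>.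
      The sets \<open>An n\<close> exhaust \<open>A\<close> and stop short of \<open>c\<close>, so
      that \<open>c - 1 / real (Suc n)\<close> can be the cut between \<open>An n\<close> and
      \<open>B\<close>.\<close>
    define An where "An n = A \<inter> {..c - 1 / real (Suc n)}" for n
    have ev: "\<forall>\<^sub>F n in sequentially. x \<in> An n \<longleftrightarrow> x \<in> A" for x
    proof (cases "x \<in> A")
      case True
      then have "x < c" using Ac' by auto
      have "(\<lambda>n. c - 1 / real (Suc n)) \<longlonglongrightarrow> c"
        using tendsto_diff[OF tendsto_const[of c] LIMSEQ_inverse_real_of_nat] by (simp add: inverse_eq_divide)
      from order_tendstoD(1)[OF this \<open>x < c\<close>] show ?thesis
        by eventually_elim (use True in \<open>auto simp: An_def\<close>)
    qed (auto simp: An_def)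
    have lim: "(\<lambda>n. measure M (An n)) \<longlonglongrightarrow> measure M A" "(\<lambda>n. measure N (An n)) \<longlonglongrightarrow> measure N A"
      using A by (intro M.tendsto_measure_eventually N.tendsto_measure_eventually ev;
          simp add: An_def M.M_is_borel N.M_is_borel)+
    show ?thesis
    proof (rule tendsto_le[OF sequentially_bot])
      show "(\<lambda>n. measure N (An n) * measure M B) \<longlonglongrightarrow> measure N A * measure M B"
        "(\<lambda>n. measure M (An n) * measure N B) \<longlonglongrightarrow> measure M A * measure N B"
        by (intro tendsto_intros lim)+
      have "B \<subseteq> {c - 1 / real (Suc n)<..}" for n

      proof
        fix b assume "b \<in> B"
        then have "c \<le> b" using cB by auto
        moreover have "c - 1 / real (Suc n) < c" by simp
        ultimately show "b \<in> {c - 1 / real (Suc n)<..}" unfolding greaterThan_iff by linarith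
      qed
      then show "\<forall>\<^sub>F n in sequentially. measure N (An n) * measure M B \<le> measure M (An n) * measure N B"
        using A B by (intro always_eventually allI sep) (auto simp: An_def)
    qed
  qed
qed auto

section \<open>Consequences of the likelihood ratio order\<close>

text \<open>Pulling constants out turns each product into an iterated integral, where the pointwise
  inequality can be integrated. It serves both for densities and for kernels; in the latter case
  \<open>S\<close> is the range, off which the kernel is arbitrary.\<close>

lemma nn_set_integral_prod_mono:
  fixes p q r s :: "'a \<Rightarrow> ennreal"
  assumes [measurable]: "p \<in> borel_measurable M" "q \<in> borel_measurable M" "r \<in> borel_measurable M" "s \<in> borel_measurable M"
    "A \<in> sets M" "B \<in> sets M"
    and S: "AE x in M. x \<in> S"
    and le: "\<And>x y. x \<in> A \<Longrightarrow> y \<in> B \<Longrightarrow> x \<in> S \<Longrightarrow> y \<in> S \<Longrightarrow> p x * q y \<le> r x * s y"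
  shows "(\<integral>\<^sup>+x\<in>A. p x \<partial>M) * (\<integral>\<^sup>+x\<in>B. q x \<partial>M) \<le> (\<integral>\<^sup>+x\<in>A. r x \<partial>M) * (\<integral>\<^sup>+x\<in>B. s x \<partial>M)"
proof -
  have "(\<integral>\<^sup>+x\<in>A. p x \<partial>M) * (\<integral>\<^sup>+x\<in>B. q x \<partial>M) = (\<integral>\<^sup>+x. \<integral>\<^sup>+y. (p x * indicator A x) * (q y * indicator B y) \<partial>M \<partial>M)"
    by (simp add: nn_integral_cmult nn_integral_multc)
  also have "\<dots> \<le> (\<integral>\<^sup>+x. \<integral>\<^sup>+y. (r x * indicator A x) * (s y * indicator B y) \<partial>M \<partial>M)"
    using S
  proof (intro nn_integral_mono_AE, eventually_elim)
    case (elim x)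
    show ?case
      using S by (intro nn_integral_mono_AE, eventually_elim)
        (use elim le in \<open>auto simp: indicator_def\<close>)
  qed
  also have "\<dots> = (\<integral>\<^sup>+x\<in>A. r x \<partial>M) * (\<integral>\<^sup>+x\<in>B. s x \<partial>M)"
    by (simp add: nn_integral_cmult nn_integral_multc)
  finally show ?thesis .
qed

lemma cross_le_if_ennreal_quotient_le:
  fixes a b c d :: real
  assumes "0 \<le> a" "0 \<le> b" "0 \<le> c" "0 \<le> d" "ennreal b / ennreal a \<le> ennreal d / ennreal c" "0 < a + b"
  shows "b * c \<le> a * d"
proof (cases "c = 0")
  case False
  then have c: "c > 0" using assms by simp
  show ?thesis
  proof (cases "a = 0")
    case True
    \<comment> \<open>Void case: \<open>b > 0\<close> makes the left quotient infinite, while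
      \<open>c > 0\<close> keeps the right one finite.\<close>
    then have "ennreal b / ennreal a = \<infinity>"
      using assms by (simp add: ennreal_divide_top ennreal_divide_zero)
    moreover have "ennreal d / ennreal c < \<infinity>"
      using c assms by (simp add: divide_ennreal)
    ultimately show ?thesis using assms by simp
  next
    case False
    then show ?thesis
      using assms c by (simp add: divide_ennreal ennreal_le_iff field_simps)
  qed
qed (use assms in simp)

text \<open>Cleared of denominators, monotonicity of the quotient is a pointwise cross inequality
  between the densities; it is integrated over \<open>B1\<close> and \<open>B2\<close>.\<close>

lemma lr_le_cross_ineq:
  assumes "Q1 \<le>\<^sub>l\<^sub>r Q2" and B: "B1 \<in> sets borel" "B2 \<in> sets borel" "set_less B1 B2"
  shows "emeasure Q1 B2 * emeasure Q2 B1 \<le> emeasure Q1 B1 * emeasure Q2 B2"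
proof -
  obtain \<mu> g1 g2 where *: "sigma_finite_measure \<mu>" "sets \<mu> = sets borel"
    "g1 \<in> borel_measurable borel" "g2 \<in> borel_measurable borel"
    "\<And>x. 0 \<le> g1 x" "\<And>x. 0 \<le> g2 x"
    "Q1 = density \<mu> (\<lambda>x. ennreal (g1 x))" "Q2 = density \<mu> (\<lambda>x. ennreal (g2 x))"
    "mono_on {x. g1 x + g2 x > 0} (\<lambda>x. ennreal (g2 x) / ennreal (g1 x))"
    using assms(1) unfolding lr_le_def by blast
  note [measurable_cong] = *(2)
  note [measurable] = *(3,4) B(1,2)
  have pt: "g2 x * g1 y \<le> g1 x * g2 y" if "x \<in> B1" "y \<in> B2" for x y
  proof (cases "g1 x + g2 x > 0 \<and> g1 y + g2 y > 0")
    case True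
    have "x \<le> y" using B that by (auto simp: set_less_def intro: less_imp_le)
    with True have "ennreal (g2 x) / ennreal (g1 x) \<le> ennreal (g2 y) / ennreal (g1 y)"
      by (intro mono_onD[OF *(9)]) auto
    with True show ?thesis
      by (intro cross_le_if_ennreal_quotient_le *(5,6)) auto
  next
    case False
    \<comment> \<open>At a point where both densities vanish monotonicity says nothing, but both
      products are zero.\<close>
    then have "g1 x = 0 \<and> g2 x = 0 \<or> g1 y = 0 \<and> g2 y = 0"
      using *(5)[of x] *(6)[of x] *(5)[of y] *(6)[of y] by linarith
    then show ?thesis by auto
  qed
  have Q: "emeasure Q1 B = (\<integral>\<^sup>+x\<in>B. ennreal (g1 x) \<partial>\<mu>)" "emeasure Q2 B = (\<integral>\<^sup>+x\<in>B. ennreal (g2 x) \<partial>\<mu>)"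
    if "B \<in> sets borel" for B
    using that by (simp_all add: *(2,7,8) emeasure_density)
  have "(\<integral>\<^sup>+x\<in>B1. ennreal (g2 x) \<partial>\<mu>) * (\<integral>\<^sup>+x\<in>B2. ennreal (g1 x) \<partial>\<mu>)
      \<le> (\<integral>\<^sup>+x\<in>B1. ennreal (g1 x) \<partial>\<mu>) * (\<integral>\<^sup>+x\<in>B2. ennreal (g2 x) \<partial>\<mu>)"
    by (rule nn_set_integral_prod_mono[where S=UNIV])
      (use pt *(5,6) in \<open>simp_all add: ennreal_mult[symmetric]\<close>)
  then show ?thesis
    by (simp add: Q B mult.commute)
qed

section \<open>Monotone densities\<close>

text \<open>By the Lindelof property countably many of the sets \<open>U x\<close> cover
  \<open>A\<close>, which is then a countable union of null sets.\<close>

lemma emeasure_eq_0_if_open_cover: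
  fixes U :: "'b \<Rightarrow> 'a :: second_countable_topology set"
  assumes M: "sets M = sets borel" and A: "A \<in> sets borel"
    and U: "\<And>x. x \<in> I \<Longrightarrow> open (U x)" "A \<subseteq> (\<Union>x\<in>I. U x)"
    and null: "\<And>x. x \<in> I \<Longrightarrow> emeasure M (A \<inter> U x) = 0"
  shows "emeasure M A = 0"
proof -
  obtain F where F: "F \<subseteq> U ` I" "countable F" "\<Union>F = \<Union>(U ` I)"
    by (rule Lindelof[of "U ` I"]) (use U in auto)
  then have "A = (\<Union>V\<in>F. A \<inter> V)" using U(2) by auto
  also have "\<dots> \<in> null_sets M"
  proof (rule null_sets_UN')
    fix V assume "V \<in> F"
    then obtain x where "x \<in> I" "V = U x" using F(1) by auto
    then show "A \<inter> V \<in> null_sets M"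
      using null A M U by (intro null_setsI) auto
  qed fact
  finally show ?thesis by (simp add: null_setsD1)
qed

text \<open>If \<open>A\<close> has a greatest element, the hypothesis at that point is the claim;
  otherwise the open rays below the points of \<open>A\<close> cover \<open>A\<close>. Exceptional
  sets can thus be tested on initial pieces, the kind of set over which \<open>mono_density\<close>
  takes its infimum.\<close>

lemma emeasure_eq_0_if_atMost_null:
  fixes M :: "'a :: {second_countable_topology, linorder_topology} measure"
  assumes M: "sets M = sets borel" and A: "A \<in> sets borel"
    and null: "\<And>x. x \<in> A \<Longrightarrow> emeasure M (A \<inter> {..x}) = 0"
  shows "emeasure M A = 0"
proof (cases "\<exists>x\<in>A. A \<subseteq> {..x}")
  case True
  then obtain x where "x \<in> A" "A \<inter> {..x} = A" by auto
  with null show ?thesis by metis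
next
  case False
  show ?thesis
  proof (rule emeasure_eq_0_if_open_cover[OF M A, of A lessThan])
    show "A \<subseteq> (\<Union>x\<in>A. {..<x})" using False by force
    show "emeasure M (A \<inter> {..<x}) = 0" if "x \<in> A" for x
    proof -
      have "emeasure M (A \<inter> {..<x}) \<le> emeasure M (A \<inter> {..x})"
        using A M by (intro emeasure_mono) auto
      with null[OF that] show ?thesis by simp
    qed
  qed simp
qed

lemma emeasure_eq_0_if_atLeast_null:
  fixes M :: "'a :: {second_countable_topology, linorder_topology} measure"
  assumes M: "sets M = sets borel" and A: "A \<in> sets borel"
    and null: "\<And>x. x \<in> A \<Longrightarrow> emeasure M (A \<inter> {x..}) = 0"
  shows "emeasure M A = 0"
proof (cases "\<exists>x\<in>A. A \<subseteq> {x..}")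
  case True
  then obtain x where "x \<in> A" "A \<inter> {x..} = A" by auto
  with null show ?thesis by metis
next
  case False
  show ?thesis
  proof (rule emeasure_eq_0_if_open_cover[OF M A, of A greaterThan])
    show "A \<subseteq> (\<Union>x\<in>A. {x<..})" using False by force
    show "emeasure M (A \<inter> {x<..}) = 0" if "x \<in> A" for x
    proof -
      have "emeasure M (A \<inter> {x<..}) \<le> emeasure M (A \<inter> {x..})"
        using A M by (intro emeasure_mono) auto
      with null[OF that] show ?thesis by simp
    qed
  qed simp
qed

section \<open>The infimum of ratios over sets to the left\<close>

text \<open>The element \<open>1\<close> keeps the set nonempty; the density is \<open>1\<close> left of the support of \<open>P\<close>.\<close>

definition mono_density :: "real measure \<Rightarrow> real measure \<Rightarrow> real \<Rightarrow> real" where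
  "mono_density P Q x =
     Inf (insert 1 {measure Q A / measure P A | A. A \<in> sets borel \<and> A \<subseteq> {..x} \<and> 0 < measure P A})"

lemma mono_density_nonneg: "0 \<le> mono_density P Q x"
  unfolding mono_density_def by (rule cInf_greatest) auto

lemma bdd_below_mono_density:
  "bdd_below (insert 1 {measure Q A / measure P A | A. A \<in> sets borel \<and> A \<subseteq> {..x} \<and> 0 < measure P A})"
  by (rule bdd_belowI[of _ 0]) auto

lemma mono_density_le_1: "mono_density P Q x \<le> 1"
  unfolding mono_density_def by (rule cInf_lower[OF _ bdd_below_mono_density]) simp

lemma mono_density_le:
  "A \<in> sets borel \<Longrightarrow> A \<subseteq> {..x} \<Longrightarrow> 0 < measure P A \<Longrightarrow> mono_density P Q x \<le> measure Q A / measure P A"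
  unfolding mono_density_def by (rule cInf_lower[OF _ bdd_below_mono_density]) blast

text \<open>The first alternative comes from the element \<open>1\<close> inserted into the
  infimum.\<close>

lemma mono_density_lessE:
  assumes "mono_density P Q x < r"
  obtains "1 < r"
  | A where "A \<in> sets borel" "A \<subseteq> {..x}" "0 < measure P A" "measure Q A / measure P A < r"
  using cInf_lessD[OF _ assms[unfolded mono_density_def]] by auto

lemma mono_density_greatest:
  assumes "r \<le> 1" "\<And>A. A \<in> sets borel \<Longrightarrow> A \<subseteq> {..x} \<Longrightarrow> 0 < measure P A \<Longrightarrow> r \<le> measure Q A / measure P A"
  shows "r \<le> mono_density P Q x"
  unfolding mono_density_def by (rule cInf_greatest) (use assms in auto)

lemma antimono_mono_density: "antimono (mono_density P Q)"
proof (rule antimonoI)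
  fix x y :: real assume "x \<le> y"
  then show "mono_density P Q y \<le> mono_density P Q x"
    by (intro mono_density_greatest mono_density_le_1 mono_density_le) auto
qed

lemma borel_measurable_mono_density [measurable]: "mono_density P Q \<in> borel_measurable borel"
proof -
  have "mono (\<lambda>x. - mono_density P Q x)"
    using antimono_mono_density[of P Q] by (auto simp: mono_def antimono_def)
  from borel_measurable_uminus[OF borel_measurable_mono[OF this]] show ?thesis by simp
qed

section \<open>Identification of the infimum with a Radon-Nikodym derivative\<close>

locale mono_ratio = P: finite_borel_measure P + Q: finite_borel_measure Q for P Q +
  assumes le: "A \<in> sets borel \<Longrightarrow> measure Q A \<le> measure P A"
    and cross: "A \<in> sets borel \<Longrightarrow> B \<in> sets borel \<Longrightarrow> set_less A B \<Longrightarrow>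
      measure Q B * measure P A \<le> measure Q A * measure P B"
begin

declare P.M_is_borel [measurable_cong] Q.M_is_borel [measurable_cong]

text \<open>A common point \<open>c\<close> does no harm: split both sets into \<open>{c}\<close>
  and the rest. The three separated pairs satisfy \<open>cross\<close>, and the remaining term, the
  product of the two masses at \<open>c\<close>, occurs on both sides.\<close>

lemma cross_weak:
  assumes A[measurable]: "A \<in> sets borel" "A \<subseteq> {..c}" and B[measurable]: "B \<in> sets borel" "B \<subseteq> {c..}"
  shows "measure Q B * measure P A \<le> measure Q A * measure P B"
proof (cases "c \<in> A \<and> c \<in> B")
  case True
  have split: "measure L C = measure L (C - {c}) + measure L {c}"
    if "finite_borel_measure L" "C \<in> sets borel" "c \<in> C" for L C
  proof -
    interpret L: finite_borel_measure L by fact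
    have "measure L (C - {c}) = measure L C - measure L {c}"
      using that by (intro L.finite_measure_Diff) (auto simp: L.M_is_borel)
    then show ?thesis by simp
  qed
  note split = split[OF P.finite_borel_measure_axioms] split[OF Q.finite_borel_measure_axioms]
  define A0 B0 where "A0 = A - {c}" and "B0 = B - {c}"
  have [measurable]: "A0 \<in> sets borel" "B0 \<in> sets borel" by (auto simp: A0_def B0_def)
  have "set_less A0 B0" "set_less A0 {c}" "set_less {c} B0"
    unfolding set_less_def A0_def B0_def using A(2) B(2) by force+
  then have "measure Q B0 * measure P A0 \<le> measure Q A0 * measure P B0"
    "measure Q {c} * measure P A0 \<le> measure Q A0 * measure P {c}"
    "measure Q B0 * measure P {c} \<le> measure Q {c} * measure P B0"
    by (auto intro!: cross)
  then show ?thesis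
    using True by (simp add: split[of A] split[of B] A0_def B0_def algebra_simps)
next
  case False
  have "set_less A B"
    unfolding set_less_def
  proof (intro ballI)
    fix a b assume "a \<in> A" "b \<in> B"
    then have "a \<le> c" "c \<le> b" "a \<noteq> c \<or> b \<noteq> c" using A B False by auto
    then show "a < b" by linarith
  qed
  then show ?thesis by (intro cross) auto
qed

text \<open>A Radon-Nikodym derivative \<open>h\<close> is compared with the infimum. If a number
  \<open>r\<close> lies strictly between the two on a set of positive mass, an initial piece of that
  set contradicts the definition of the infimum, or a final piece contradicts the decrease of the
  ratios.\<close>

lemma density_eq: "Q = density P (\<lambda>x. ennreal (mono_density P Q x))"
proof -
  have le': "emeasure Q A \<le> emeasure P A" if "A \<in> sets borel" for A
    using le[OF that] by (simp add: P.emeasure_eq_measure Q.emeasure_eq_measure)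
  have ac: "absolutely_continuous P Q"
    unfolding absolutely_continuous_def null_sets_def
    using le' by (auto simp: P.M_is_borel Q.M_is_borel) (metis le_zero_eq)
  have "sets Q = sets P" by (simp add: P.M_is_borel Q.M_is_borel)
  then obtain h where [measurable]: "h \<in> borel_measurable borel" and h: "density P h = Q"
    using P.Radon_Nikodym[OF ac] by (auto simp: measurable_cong_sets[OF P.M_is_borel refl])
  have Q_eq: "emeasure Q A = (\<integral>\<^sup>+x\<in>A. h x \<partial>P)" if "A \<in> sets borel" for A
    using that by (subst h[symmetric], subst emeasure_density) (auto simp: P.M_is_borel)
  have Q_upper: "measure Q A \<le> r * measure P A"
    if A: "A \<in> sets borel" "0 \<le> r" "\<And>x. x \<in> A \<Longrightarrow> h x \<le> ennreal r" for A r
  proof -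
    have "emeasure Q A \<le> (\<integral>\<^sup>+x. ennreal r * indicator A x \<partial>P)"
      unfolding Q_eq[OF A(1)] by (intro nn_integral_mono) (auto simp: indicator_def A)
    also have "\<dots> = ennreal (r * measure P A)"
      using A by (subst nn_integral_cmult_indicator) (auto simp: P.M_is_borel P.emeasure_eq_measure ennreal_mult)
    finally show ?thesis
      using A by (simp add: Q.emeasure_eq_measure)
  qed
  have Q_lower: "r * measure P A \<le> measure Q A"
    if A: "A \<in> sets borel" "0 \<le> r" "\<And>x. x \<in> A \<Longrightarrow> ennreal r \<le> h x" for A r
  proof -
    have "ennreal (r * measure P A) = (\<integral>\<^sup>+x. ennreal r * indicator A x \<partial>P)"
      using A by (subst nn_integral_cmult_indicator) (auto simp: P.M_is_borel P.emeasure_eq_measure ennreal_mult)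
    also have "\<dots> \<le> emeasure Q A"
      unfolding Q_eq[OF A(1)] by (intro nn_integral_mono) (auto simp: indicator_def A)
    finally show ?thesis
      using A by (simp add: Q.emeasure_eq_measure)
  qed
  let ?G = "mono_density P Q"
  have 1: "AE x in P. \<not> (h x < ennreal r \<and> ennreal r < ennreal (?G x))" for r :: real
  proof -
    define A where "A = {x. h x < ennreal r \<and> ennreal r < ennreal (?G x)}"
    have [measurable]: "A \<in> sets borel" unfolding A_def by measurable
    have "emeasure P A = 0"
    proof (rule emeasure_eq_0_if_atMost_null[OF P.M_is_borel])
      fix x assume x: "x \<in> A"
      then have "0 < ennreal r" using le_less_trans[OF zero_le, of "h x" "ennreal r"] by (simp add: A_def)
      then have r: "0 < r" by simp
      \<comment> \<open>With positive mass, the initial piece would itself compete in the infimum at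
        \<open>x\<close>, with a ratio at most \<open>r\<close>, although
        \<open>r < ?G x\<close>.\<close>
      have "\<not> 0 < measure P (A \<inter> {..x})"
      proof
        assume pos: "0 < measure P (A \<inter> {..x})"
        then have "?G x \<le> measure Q (A \<inter> {..x}) / measure P (A \<inter> {..x})"
          by (intro mono_density_le) auto
        also have "measure Q (A \<inter> {..x}) \<le> r * measure P (A \<inter> {..x})"
          using r by (intro Q_upper) (auto simp: A_def)
        then have "measure Q (A \<inter> {..x}) / measure P (A \<inter> {..x}) \<le> r"
          using pos by (simp add: field_simps)
        finally show False
          using x r by (simp add: A_def ennreal_less_iff)
      qed
      then show "emeasure P (A \<inter> {..x}) = 0"
        by (simp add: P.emeasure_eq_measure zero_less_measure_iff)
    qed simp
    then have "A \<in> null_sets P" by (intro null_setsI) (auto simp: P.M_is_borel)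
    from AE_not_in[OF this] show ?thesis by eventually_elim (auto simp: A_def)
  qed
  have 2: "AE x in P. \<not> (ennreal (?G x) < ennreal r \<and> ennreal r < h x)" for r :: real
  proof -
    define A where "A = {x. ennreal (?G x) < ennreal r \<and> ennreal r < h x}"
    have [measurable]: "A \<in> sets borel" unfolding A_def by measurable
    have "emeasure P A = 0"
    proof (rule emeasure_eq_0_if_atLeast_null[OF P.M_is_borel])
      fix x assume x: "x \<in> A"
      then have Gr: "?G x < r"
        using mono_density_nonneg by (simp add: A_def ennreal_less_iff)
      then have r: "0 < r" using mono_density_nonneg[of P Q x] by linarith
      let ?B = "A \<inter> {x..}"
      have lower: "r * measure P ?B \<le> measure Q ?B"
        using r by (intro Q_lower) (auto simp: A_def)
      have "\<not> 0 < measure P ?B"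
      proof
        assume pos: "0 < measure P ?B"
        from Gr show False
        proof (cases rule: mono_density_lessE)
          \<comment> \<open>On a set of positive mass a ratio above \<open>1\<close> contradicts the
            domination of \<open>Q\<close> by \<open>P\<close>.\<close>
          case 1
          have "1 * measure P ?B < r * measure P ?B"
            using pos 1 by (intro mult_strict_right_mono)
          with lower le[of ?B] show False by simp
        next
          \<comment> \<open>\<open>C\<close> lies left of \<open>x\<close> with ratio below
            \<open>r\<close>, and \<open>?B\<close> lies right of \<open>x\<close> with ratio at
            least \<open>r\<close>, so the ratio would increase. Both may contain \<open>x\<close>,
            hence \<open>cross_weak\<close>.\<close>
          case (2 C)
          have "r * measure P ?B * measure P C \<le> measure Q ?B * measure P C"
            using lower by (intro mult_right_mono) auto
          also have "\<dots> \<le> measure Q C * measure P ?B"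
            using 2 by (intro cross_weak[of _ x]) auto
          also have "measure Q C < r * measure P C"
            using 2 by (simp add: field_simps)
          then have "measure Q C * measure P ?B < r * measure P C * measure P ?B"
            using pos by (intro mult_strict_right_mono)
          finally show False by (simp add: ac_simps)
        qed
      qed
      then show "emeasure P ?B = 0"
        by (simp add: P.emeasure_eq_measure zero_less_measure_iff)
    qed simp
    then have "A \<in> null_sets P" by (intro null_setsI) (auto simp: P.M_is_borel)
    from AE_not_in[OF this] show ?thesis by eventually_elim (auto simp: A_def)
  qed
  \<comment> \<open>Rational thresholds suffice: there are countably many exceptional sets, and a
    rational separates any two distinct values.\<close>
  have "AE x in P. \<forall>q. \<not> (h x < ennreal (real_of_rat q) \<and> ennreal (real_of_rat q) < ennreal (?G x)) \<and>
      \<not> (ennreal (?G x) < ennreal (real_of_rat q) \<and> ennreal (real_of_rat q) < h x)"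
    using 1 2 by (auto simp: AE_all_countable)
  then have "AE x in P. h x = ennreal (?G x)"
  proof eventually_elim
    case (elim x)
    show ?case
    proof (rule ccontr)
      assume "h x \<noteq> ennreal (?G x)"
      then consider "h x < ennreal (?G x)" | "ennreal (?G x) < h x" by fastforce
      then show False
        using elim ennreal_rat_dense by cases blast+
    qed
  qed
  then have "density P h = density P (\<lambda>x. ennreal (?G x))"
    by (intro density_cong) auto
  with h show ?thesis by simp
qed

end

section \<open>A sufficient condition for the likelihood ratio order\<close>

text \<open>With respect to \<open>Q1 + Q2\<close> the law \<open>Q1\<close> has a nonincreasing
  density with values between \<open>0\<close> and \<open>1\<close>, and \<open>Q2\<close> has the
  complementary density. Their quotient is therefore nondecreasing everywhere.\<close>

lemma lr_leI:
  assumes Q1: "finite_borel_measure Q1" and Q2: "finite_borel_measure Q2"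
    and cross: "\<And>A B. A \<in> sets borel \<Longrightarrow> B \<in> sets borel \<Longrightarrow> set_less A B \<Longrightarrow>
      measure Q1 B * measure Q2 A \<le> measure Q1 A * measure Q2 B"
  shows "Q1 \<le>\<^sub>l\<^sub>r Q2"
proof -
  interpret Q1: finite_borel_measure Q1 by fact
  interpret Q2: finite_borel_measure Q2 by fact
  define \<mu> where "\<mu> = sum_measure Q1 Q2"
  have sets: "sets Q2 = sets Q1" by (simp add: Q1.M_is_borel Q2.M_is_borel)
  have sets_\<mu> [measurable_cong]: "sets \<mu> = sets borel" by (simp add: \<mu>_def Q1.M_is_borel)
  have measure_\<mu>: "measure \<mu> A = measure Q1 A + measure Q2 A" if "A \<in> sets borel" for A
    unfolding \<mu>_def using that
    by (intro measure_sum_measure Q1.finite_measure_axioms Q2.finite_measure_axioms sets)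
      (simp add: Q1.M_is_borel)
  interpret \<mu>: finite_borel_measure \<mu>
    unfolding \<mu>_def
    by (intro finite_borel_measure.intro finite_measure_sum_measure finite_borel_measure_axioms.intro
        Q1.finite_measure_axioms Q2.finite_measure_axioms sets) (simp add: Q1.M_is_borel)
  \<comment> \<open>Replacing \<open>Q2\<close> by the sum adds the same product
    \<open>measure Q1 A * measure Q1 B\<close> to both sides of the cross inequality.\<close>
  interpret mono_ratio \<mu> Q1
    by standard (auto simp: measure_\<mu> algebra_simps dest: cross)
  let ?G = "mono_density \<mu> Q1"
  have "Q2 = density \<mu> (\<lambda>x. ennreal (1 - ?G x))"
  proof (rule measure_eqI)
    fix A assume "A \<in> sets Q2"
    then have A [measurable]: "A \<in> sets borel" by (simp add: Q2.M_is_borel)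
    have "emeasure Q1 A + emeasure Q2 A = emeasure \<mu> A"
      unfolding \<mu>_def using A by (subst emeasure_sum_measure[OF sets]) (auto simp: Q1.M_is_borel)
    also have "\<dots> = (\<integral>\<^sup>+x\<in>A. 1 \<partial>\<mu>)" by simp
    also have "\<dots> = (\<integral>\<^sup>+x. ennreal (?G x) * indicator A x + ennreal (1 - ?G x) * indicator A x \<partial>\<mu>)"
      by (intro nn_integral_cong)
        (auto simp: indicator_def mono_density_nonneg mono_density_le_1 ennreal_plus[symmetric] simp del: ennreal_plus)
    also have "\<dots> = emeasure (density \<mu> (\<lambda>x. ennreal (?G x))) A + emeasure (density \<mu> (\<lambda>x. ennreal (1 - ?G x))) A"
      by (subst nn_integral_add) (auto simp: emeasure_density)
    also have "density \<mu> (\<lambda>x. ennreal (?G x)) = Q1"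
      by (rule density_eq[symmetric])
    finally show "emeasure Q2 A = emeasure (density \<mu> (\<lambda>x. ennreal (1 - ?G x))) A"
      by (simp add: ennreal_add_left_cancel)
  qed (simp add: sets_\<mu> Q2.M_is_borel)
  moreover have "mono_on {x. 0 < ?G x + (1 - ?G x)} (\<lambda>x. ennreal (1 - ?G x) / ennreal (?G x))"
  proof (rule mono_onI)
    fix x y :: real assume "x \<le> y"
    then have "?G y \<le> ?G x" using antimono_mono_density by (rule antimonoD[rotated])
    \<comment> \<open>The quotient is a product of two nondecreasing factors. Where
      \<open>?G y = 0\<close>, the inverse is \<open>\<infinity>\<close> and the bound is
      immediate.\<close>
    moreover have "inverse (ennreal (?G x)) \<le> inverse (ennreal (?G y))"
    proof (cases "?G y = 0")
      case False
      with mono_density_nonneg[of \<mu> Q1 y] have "0 < ?G y" by simp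
      with \<open>?G y \<le> ?G x\<close> show ?thesis
        by (simp add: inverse_ennreal ennreal_leI le_imp_inverse_le)
    qed simp
    ultimately show "ennreal (1 - ?G x) / ennreal (?G x) \<le> ennreal (1 - ?G y) / ennreal (?G y)"
      unfolding divide_ennreal_def by (intro mult_mono ennreal_leI) auto
  qed
  ultimately show ?thesis
    unfolding lr_le_def
    using density_eq mono_density_nonneg mono_density_le_1 sets_\<mu> \<mu>.sigma_finite_measure_axioms
    by (intro exI[of _ \<mu>] exI[of _ ?G] exI[of _ "\<lambda>x. 1 - ?G x"]) auto
qed

section \<open>Monotone densities as limits of ratios\<close>

text \<open>The intervals \<open>edge_Ioc P x n\<close> do not depend on \<open>Q\<close>, so the ratios over them converge
  simultaneously for all the conditional distribution functions. The edge is smaller than \<open>x\<close> if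
  there is a gap of \<open>P\<close> to the left of \<open>x\<close>.\<close>

definition right_edge :: "real measure \<Rightarrow> real \<Rightarrow> real" where
  "right_edge P x = Sup {a. a < x \<and> 0 < measure P {a<..x}}"

definition edge_Ioc :: "real measure \<Rightarrow> real \<Rightarrow> nat \<Rightarrow> real set" where
  "edge_Ioc P x n = {right_edge P x - 1 / real (Suc n)<..x}"

lemma edge_Ioc_borel [measurable]: "edge_Ioc P x n \<in> sets borel"
  and edge_Ioc_subset: "edge_Ioc P x n \<subseteq> {..x}"
  by (auto simp: edge_Ioc_def)

text \<open>The left endpoints increase strictly to the edge, so the edge itself stays in the limit,
  which is a closed interval.\<close>

lemma eventually_edge_Ioc:
  "\<forall>\<^sub>F n in sequentially. z \<in> edge_Ioc P x n \<longleftrightarrow> z \<in> {right_edge P x..x}"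
proof (cases "z < right_edge P x")
  case True
  have "(\<lambda>n. right_edge P x - 1 / real (Suc n)) \<longlonglongrightarrow> right_edge P x"
    using tendsto_diff[OF tendsto_const LIMSEQ_inverse_real_of_nat] by (simp add: inverse_eq_divide)
  from order_tendstoD(1)[OF this True] show ?thesis
    by eventually_elim (use True in \<open>auto simp: edge_Ioc_def\<close>)
next
  case False
  have "right_edge P x - 1 / real (Suc n) < right_edge P x" for n by simp
  with False have "right_edge P x - 1 / real (Suc n) < z" for n by (meson less_le_trans not_less)
  with False show ?thesis by (simp add: edge_Ioc_def)
qed

context finite_borel_measure
begin

lemma bdd_above_right_edge: "bdd_above {a. a < x \<and> 0 < measure M {a<..x}}"
  by (rule bdd_aboveI[of _ x]) auto

lemma le_right_edge: "a < x \<Longrightarrow> 0 < measure M {a<..x} \<Longrightarrow> a \<le> right_edge M x"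
  unfolding right_edge_def by (rule cSup_upper[OF _ bdd_above_right_edge]) simp

text \<open>By the choice of the edge as a supremum, \<open>{z<..x}\<close> is null for every
  \<open>z\<close> strictly between the edge and \<open>x\<close>; these intervals contain all final
  pieces of \<open>{right_edge M x<..x}\<close>.\<close>

lemma measure_Ioc_right_edge: "measure M {right_edge M x<..x} = 0"
proof -
  have "emeasure M {right_edge M x<..x} = 0"
  proof (rule emeasure_eq_0_if_atLeast_null[OF M_is_borel])
    fix y assume y: "y \<in> {right_edge M x<..x}"
    then obtain z where z: "right_edge M x < z" "z < y" using dense by auto
    then have "measure M {z<..x} = 0"
      using le_right_edge[of z x] y by (auto simp: not_le zero_less_measure_iff)
    moreover have "emeasure M ({right_edge M x<..x} \<inter> {y..}) \<le> emeasure M {z<..x}"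
      using z by (intro emeasure_mono) (auto simp: M_is_borel)
    ultimately show "emeasure M ({right_edge M x<..x} \<inter> {y..}) = 0"
      by (simp add: emeasure_eq_measure)
  qed simp
  then show ?thesis by (simp add: measure_def)
qed

context
  fixes x assumes pos: "0 < measure M {..x}"
begin

text \<open>Secures the supremum in \<open>right_edge\<close>: far to the left, the distribution
  function falls below its positive value at \<open>x\<close>.\<close>

lemma right_edge_nonempty: "{a. a < x \<and> 0 < measure M {a<..x}} \<noteq> {}"
proof -
  have "\<forall>\<^sub>F a in at_bot. cdf M a < cdf M x \<and> a < x"
    using order_tendstoD(2)[OF cdf_lim_at_bot, of "cdf M x"] pos
    by (intro eventually_conj eventually_gt_at_bot) (auto simp: cdf_def2)
  then obtain a where "cdf M a < cdf M x" "a < x"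
    using eventually_happens'[of at_bot] trivial_limit_at_bot_linorder by blast
  then show ?thesis using cdf_diff_eq[of a x] by auto
qed

lemma measure_edge_Ioc_pos: "0 < measure M (edge_Ioc M x n)"
proof -
  have "right_edge M x - 1 / real (Suc n) < right_edge M x" by simp
  then obtain a where a: "a < x" "0 < measure M {a<..x}" "right_edge M x - 1 / real (Suc n) < a"
    using less_cSupD[OF right_edge_nonempty] unfolding right_edge_def by blast
  then have "measure M {a<..x} \<le> measure M (edge_Ioc M x n)"
    by (intro finite_measure_mono) (auto simp: edge_Ioc_def M_is_borel)
  with a show ?thesis by simp
qed

end

lemma measure_Int_atMost_eq:
  assumes "A \<in> sets borel" "A \<subseteq> {..x}" "measure M {s<..x} = 0"
  shows "measure M (A \<inter> {..s}) = measure M A"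
proof -
  have "measure M (A - {..s}) \<le> measure M {s<..x}"
    using assms by (intro finite_measure_mono) (auto simp: M_is_borel)
  then have "measure M (A - {..s}) = 0"
    using assms(3) by (simp add: measure_le_0_iff)
  moreover have "measure M (A - {..s}) = measure M A - measure M (A \<inter> {..s})"
    using assms by (intro finite_measure_Diff') (auto simp: M_is_borel)
  ultimately show ?thesis by simp
qed

text \<open>Mass in \<open>{x<..y}\<close> puts the edge of \<open>y\<close> at or beyond
  \<open>x\<close>, and equality would make that interval null. Hence the edge intervals of two
  points with mass in between are eventually separated.\<close>

lemma eventually_edge_Ioc_subset:
  assumes "x < y" "0 < measure M {x<..y}"
  shows "\<forall>\<^sub>F n in sequentially. edge_Ioc M y n \<subseteq> {x<..}"
proof -
  have "x \<le> right_edge M y" using assms by (rule le_right_edge)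
  moreover have "x \<noteq> right_edge M y" using assms measure_Ioc_right_edge[of y] by auto
  ultimately have "x < right_edge M y" by simp
  moreover have "(\<lambda>n. right_edge M y - 1 / real (Suc n)) \<longlonglongrightarrow> right_edge M y"
    using tendsto_diff[OF tendsto_const LIMSEQ_inverse_real_of_nat] by (simp add: inverse_eq_divide)
  ultimately have "\<forall>\<^sub>F n in sequentially. x < right_edge M y - 1 / real (Suc n)"
    by (rule order_tendstoD(1)[rotated])
  then show ?thesis
    by eventually_elim (auto simp: edge_Ioc_def)
qed

end

section \<open>Behaviour on gaps and convergence of edge ratios\<close>

context mono_ratio
begin

lemma measure_Q_eq_0: "A \<in> sets borel \<Longrightarrow> measure P A = 0 \<Longrightarrow> measure Q A = 0"
  using le[of A] by (simp add: measure_le_0_iff)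

text \<open>Cutting a set off at \<open>x\<close> removes only a null part, so both points have the
  same ratios to compete in the infimum.\<close>

lemma mono_density_eq_on_gap:
  assumes "x \<le> y" "measure P {x<..y} = 0"
  shows "mono_density P Q x = mono_density P Q y"
proof (rule antisym)
  show "mono_density P Q x \<le> mono_density P Q y"
  proof (rule mono_density_greatest[OF mono_density_le_1])
    fix A assume A: "A \<in> sets borel" "A \<subseteq> {..y}" "0 < measure P A"
    have "measure P (A \<inter> {..x}) = measure P A" "measure Q (A \<inter> {..x}) = measure Q A"
      using A assms measure_Q_eq_0 by (auto intro!: P.measure_Int_atMost_eq Q.measure_Int_atMost_eq)
    with mono_density_le[of "A \<inter> {..x}" x P Q] A
    show "mono_density P Q x \<le> measure Q A / measure P A" by simp
  qed
qed (use antimono_mono_density assms in \<open>auto dest: antimonoD\<close>)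

text \<open>Each edge interval competes in the infimum, which gives the lower bound. For the upper
  bound, a competitor \<open>A\<close> with ratio below \<open>r\<close> is first enlarged by the
  limit \<open>T\<close> of the edge intervals, then by the intervals themselves, and finally
  reduced to the interval; each step keeps the ratio below \<open>r\<close>, from some index
  on.\<close>

lemma edge_ratio_tendsto:
  assumes pos: "0 < measure P {..x}"
  shows "(\<lambda>n. measure Q (edge_Ioc P x n) / measure P (edge_Ioc P x n)) \<longlonglongrightarrow> mono_density P Q x"
proof (rule order_tendstoI)
  fix r assume r: "r < mono_density P Q x"
  have "mono_density P Q x \<le> measure Q (edge_Ioc P x n) / measure P (edge_Ioc P x n)" for n
    using P.measure_edge_Ioc_pos[OF pos] edge_Ioc_subset by (intro mono_density_le) auto
  with r show "\<forall>\<^sub>F n in sequentially. r < measure Q (edge_Ioc P x n) / measure P (edge_Ioc P x n)"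
    by (intro always_eventually allI) (rule less_le_trans)
next
  fix r assume "mono_density P Q x < r"
  then show "\<forall>\<^sub>F n in sequentially. measure Q (edge_Ioc P x n) / measure P (edge_Ioc P x n) < r"
  proof (cases rule: mono_density_lessE)
    case 1
    have "measure Q (edge_Ioc P x n) / measure P (edge_Ioc P x n) \<le> 1" for n
      using le[of "edge_Ioc P x n"] P.measure_edge_Ioc_pos[OF pos, of n] by (simp add: divide_le_eq_1)
    with 1 show ?thesis by (intro always_eventually allI) (rule le_less_trans)
  next
    case (2 A)
    note [measurable] = 2(1)
    define s where "s = right_edge P x"
    define T where "T = {s..x}"
    have [measurable]: "T \<in> sets borel" by (simp add: T_def)
    have gap: "measure P {s<..x} = 0" unfolding s_def by (rule P.measure_Ioc_right_edge)
    have A_s: "measure P (A \<inter> {..s}) = measure P A" "measure Q (A \<inter> {..s}) = measure Q A"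
      using 2 gap measure_Q_eq_0 by (auto intro!: P.measure_Int_atMost_eq Q.measure_Int_atMost_eq)
    have un: "measure P (A \<union> B) = measure P A + measure P (B - A)"
      "measure Q (A \<union> B) = measure Q A + measure Q (B - A)"
      "measure P (A \<union> B) = measure P (A - B) + measure P B"
      "measure Q (A \<union> B) = measure Q (A - B) + measure Q B"
      if [measurable]: "B \<in> sets borel" for B
    proof -
      have "A \<union> B = A \<union> (B - A)" "A \<inter> (B - A) = {}" "A \<union> B = (A - B) \<union> B" "(A - B) \<inter> B = {}" by auto
      then show "measure P (A \<union> B) = measure P A + measure P (B - A)"
        "measure Q (A \<union> B) = measure Q A + measure Q (B - A)"
        "measure P (A \<union> B) = measure P (A - B) + measure P B"
        "measure Q (A \<union> B) = measure Q (A - B) + measure Q B"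
        by (metis P.finite_measure_Union Q.finite_measure_Union P.M_is_borel Q.M_is_borel
            2(1) that sets.Diff)+
    qed
    \<comment> \<open>Up to a null set \<open>A\<close> lies left of the edge and \<open>T\<close>
      right of it, so that adding \<open>T\<close> does not raise the ratio.\<close>
    have "measure Q (T - A) * measure P (A \<inter> {..s}) \<le> measure Q (A \<inter> {..s}) * measure P (T - A)"
      by (rule cross_weak[of _ s]) (auto simp: T_def)
    then have "measure Q (A \<union> T) * measure P A \<le> measure Q A * measure P (A \<union> T)"
      unfolding A_s by (simp add: un(1,2) algebra_simps)
    moreover have P_pos: "0 < measure P (A \<union> T)"
      using 2 P.finite_measure_mono[of A "A \<union> T"] by (auto simp: P.M_is_borel)
    ultimately have "measure Q (A \<union> T) / measure P (A \<union> T) \<le> measure Q A / measure P A"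
      using 2 by (simp add: field_simps)
    also note 2(4)
    finally have T_less: "measure Q (A \<union> T) / measure P (A \<union> T) < r" .
    have ev: "\<forall>\<^sub>F n in sequentially. z \<in> A \<union> edge_Ioc P x n \<longleftrightarrow> z \<in> A \<union> T" for z
      using eventually_edge_Ioc[of z P x] by eventually_elim (auto simp: T_def s_def)
    have "(\<lambda>n. measure Q (A \<union> edge_Ioc P x n) / measure P (A \<union> edge_Ioc P x n))
        \<longlonglongrightarrow> measure Q (A \<union> T) / measure P (A \<union> T)"
      using P_pos by (intro tendsto_divide P.tendsto_measure_eventually Q.tendsto_measure_eventually ev)
        (auto simp: P.M_is_borel Q.M_is_borel)
    from order_tendstoD(2)[OF this T_less] show ?thesis
    proof eventually_elim
      case (elim n)
      let ?I = "edge_Ioc P x n"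
      have I: "0 < measure P ?I" by (rule P.measure_edge_Ioc_pos[OF pos])
      \<comment> \<open>What \<open>A\<close> has outside the interval lies to its left and has the
        larger ratio; discarding it does not raise the ratio.\<close>
      have "set_less (A - ?I) ?I"
        using 2(2) by (auto simp: set_less_def edge_Ioc_def)
      then have "measure Q ?I * measure P (A - ?I) \<le> measure Q (A - ?I) * measure P ?I"
        by (intro cross) auto
      then have "measure Q ?I * measure P (A \<union> ?I) \<le> measure Q (A \<union> ?I) * measure P ?I"
        by (simp add: un(3,4) algebra_simps)
      moreover have "0 < measure P (A \<union> ?I)"
        using I P.finite_measure_mono[of ?I "A \<union> ?I"] by (auto simp: P.M_is_borel)
      ultimately have "measure Q ?I / measure P ?I \<le> measure Q (A \<union> ?I) / measure P (A \<union> ?I)"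
        using I by (simp add: field_simps)
      with elim show ?case by simp
    qed
  qed
qed

end

section \<open>Laws on the plane\<close>

lemma finite_borel_measure_distr_density:
  assumes "finite_measure M" and f[measurable]: "f \<in> borel_measurable M" and S[measurable]: "S \<in> sets M"
  shows "finite_borel_measure (distr (density M (indicator S)) borel f)"
    and "B \<in> sets borel \<Longrightarrow>
      emeasure (distr (density M (indicator S)) borel f) B = emeasure M ({x\<in>space M. f x \<in> B} \<inter> S)"
proof -
  interpret finite_measure M by fact
  show em: "emeasure (distr (density M (indicator S)) borel f) B = emeasure M ({x\<in>space M. f x \<in> B} \<inter> S)"
    if [measurable]: "B \<in> sets borel" for B
  proof -
    have "f -` B \<inter> space M = {x\<in>space M. f x \<in> B}" by auto
    moreover have "{x\<in>space M. f x \<in> B} \<in> sets M" by measurable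
    ultimately show ?thesis
      by (simp add: emeasure_distr emeasure_density indicator_inter_arith[symmetric] mult.commute Int_commute)
  qed
  have "emeasure (distr (density M (indicator S)) borel f) UNIV \<noteq> \<infinity>"
    by (subst em) auto
  then have "finite_measure (distr (density M (indicator S)) borel f)"
    by (intro finite_measureI) simp
  then show "finite_borel_measure (distr (density M (indicator S)) borel f)"
    by (intro finite_borel_measure.intro finite_borel_measure_axioms.intro) auto
qed

text \<open>With one side of a rectangle fixed, its probability is a measure in the other side, to
  which the comparisons on the line apply. For \<open>B = UNIV\<close> it is the first
  marginal.\<close>

definition fst_slice :: "(real \<times> real) measure \<Rightarrow> real set \<Rightarrow> real measure" where
  "fst_slice R B = distr (density R (indicator (UNIV \<times> B))) borel fst"

definition snd_slice :: "(real \<times> real) measure \<Rightarrow> real set \<Rightarrow> real measure" where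
  "snd_slice R A = distr (density R (indicator (A \<times> UNIV))) borel snd"

locale prob_plane = prob_space R for R :: "(real \<times> real) measure" +
  assumes sets_R [measurable_cong]: "sets R = sets (borel \<Otimes>\<^sub>M borel)"
begin

lemma space_R: "space R = UNIV"
  using sets_eq_imp_space_eq[OF sets_R] by (simp add: space_pair_measure)

lemma finite_borel_measure_fst_slice: "B \<in> sets borel \<Longrightarrow> finite_borel_measure (fst_slice R B)"
  unfolding fst_slice_def
  by (intro finite_borel_measure_distr_density) (auto simp: finite_measure_axioms sets_R)

lemma finite_borel_measure_snd_slice: "A \<in> sets borel \<Longrightarrow> finite_borel_measure (snd_slice R A)"
  unfolding snd_slice_def
  by (intro finite_borel_measure_distr_density) (auto simp: finite_measure_axioms sets_R)

lemma emeasure_fst_slice: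
  assumes [measurable]: "A \<in> sets borel" "B \<in> sets borel"
  shows "emeasure (fst_slice R B) A = emeasure R (A \<times> B)"
proof -
  have "{x \<in> space R. fst x \<in> A} \<inter> UNIV \<times> B = A \<times> B" by (auto simp: space_R)
  then show ?thesis
    unfolding fst_slice_def
    by (subst finite_borel_measure_distr_density(2)[OF finite_measure_axioms]) (auto simp: sets_R)
qed

lemma emeasure_snd_slice:
  assumes [measurable]: "A \<in> sets borel" "B \<in> sets borel"
  shows "emeasure (snd_slice R A) B = emeasure R (A \<times> B)"
proof -
  have "{x \<in> space R. snd x \<in> B} \<inter> A \<times> UNIV = A \<times> B" by (auto simp: space_R)
  then show ?thesis
    unfolding snd_slice_def
    by (subst finite_borel_measure_distr_density(2)[OF finite_measure_axioms]) (auto simp: sets_R)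
qed

lemma measure_slice:
  assumes "A \<in> sets borel" "B \<in> sets borel"
  shows measure_fst_slice: "measure (fst_slice R B) A = measure R (A \<times> B)"
    and measure_snd_slice: "measure (snd_slice R A) B = measure R (A \<times> B)"
  using emeasure_fst_slice[OF assms] emeasure_snd_slice[OF assms] by (simp_all add: measure_def)

text \<open>Two applications of \<open>cross_ineq_borel\<close>: first in the first coordinate, with
  adjacent intervals fixed in the second, then in the second, with the Borel sets \<open>A1\<close>
  and \<open>A2\<close> fixed.\<close>

lemma lr_ineq_borel_if_Ioc:
  assumes D: "closure D = UNIV"
    and le: "\<And>x0 x1 x2 y0 y1 y2. x0 \<in> D \<Longrightarrow> x1 \<in> D \<Longrightarrow> x2 \<in> D \<Longrightarrow> y0 \<in> D \<Longrightarrow> y1 \<in> D \<Longrightarrow> y2 \<in> D \<Longrightarrow>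
      x0 < x1 \<Longrightarrow> x1 < x2 \<Longrightarrow> y0 < y1 \<Longrightarrow> y1 < y2 \<Longrightarrow> lr_ineq R {x0<..x1} {x1<..x2} {y0<..y1} {y1<..y2}"
    and A: "A1 \<in> sets borel" "A2 \<in> sets borel" "set_less A1 A2"
    and B: "B1 \<in> sets borel" "B2 \<in> sets borel" "set_less B1 B2"
  shows "lr_ineq R A1 A2 B1 B2"
proof -
  have 1: "measure R (A1 \<times> {y1<..y2}) * measure R (A2 \<times> {y0<..y1})
      \<le> measure R (A1 \<times> {y0<..y1}) * measure R (A2 \<times> {y1<..y2})"
    if y: "y0 \<in> D" "y1 \<in> D" "y2 \<in> D" "y0 < y1" "y1 < y2" for y0 y1 y2
    using cross_ineq_borel[OF finite_borel_measure_fst_slice[of "{y0<..y1}"]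
        finite_borel_measure_fst_slice[of "{y1<..y2}"] D _ A] le[OF _ _ _ y(1,2,3) _ _ y(4,5)]
    by (simp add: measure_fst_slice A lr_ineq_def)
  have "measure (snd_slice R A2) B1 * measure (snd_slice R A1) B2
      \<le> measure (snd_slice R A1) B1 * measure (snd_slice R A2) B2"
  proof (rule cross_ineq_borel[OF finite_borel_measure_snd_slice finite_borel_measure_snd_slice D _ B])
    fix y0 y1 y2 assume "y0 \<in> D" "y1 \<in> D" "y2 \<in> D" "y0 < y1" "y1 < y2"
    from 1[OF this] show "measure (snd_slice R A2) {y0<..y1} * measure (snd_slice R A1) {y1<..y2}
        \<le> measure (snd_slice R A1) {y0<..y1} * measure (snd_slice R A2) {y1<..y2}"
      by (simp add: measure_snd_slice A mult.commute)
  qed (use A in auto)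
  then show ?thesis
    by (simp add: measure_snd_slice A B lr_ineq_def mult.commute)
qed

abbreviation "P \<equiv> fst_slice R UNIV"

definition "supp_range = {x. 0 < measure P {..x} \<and> 0 < measure P {x..}}"

sublocale P: real_distribution P
proof -
  interpret P: finite_borel_measure P by (rule finite_borel_measure_fst_slice) simp
  have "emeasure P (space P) = 1"
    using emeasure_space_1 by (simp add: P.borel_UNIV emeasure_fst_slice space_R)
  then show "real_distribution P"
    by (intro real_distribution.intro prob_spaceI real_distribution_axioms.intro P.M_is_borel)
qed

lemma measurable_measure_ray [measurable]:
  "(\<lambda>x. measure P {..x}) \<in> borel_measurable borel" "(\<lambda>x. measure P {x..}) \<in> borel_measurable borel"
proof -
  have "mono (\<lambda>x. measure P {..x})" "mono (\<lambda>x. - measure P {x..})"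
    by (auto simp: mono_def intro!: P.finite_measure_mono)
  note this[THEN borel_measurable_mono]
  from this(1) borel_measurable_uminus[OF this(2)] show
    "(\<lambda>x. measure P {..x}) \<in> borel_measurable borel" "(\<lambda>x. measure P {x..}) \<in> borel_measurable borel"
    by simp_all
qed

lemma supp_range_borel [measurable]: "supp_range \<in> sets borel"
  unfolding supp_range_def by measurable

text \<open>The points with no mass at or below them form a set with null initial pieces, and dually
  on the other side. The values of a kernel off the range thus do not affect integrals under
  \<open>P\<close>.\<close>

lemma AE_supp_range: "AE x in P. x \<in> supp_range"
proof -
  have "emeasure P {x. measure P {..x} = 0} = 0"
  proof (rule emeasure_eq_0_if_atMost_null)
    fix x assume "x \<in> {x. measure P {..x} = 0}"
    moreover have "emeasure P ({x. measure P {..x} = 0} \<inter> {..x}) \<le> emeasure P {..x}"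
      by (intro emeasure_mono) auto
    ultimately show "emeasure P ({x. measure P {..x} = 0} \<inter> {..x}) = 0"
      by (simp add: P.emeasure_eq_measure)
  qed auto
  moreover have "emeasure P {x. measure P {x..} = 0} = 0"
  proof (rule emeasure_eq_0_if_atLeast_null)
    fix x assume "x \<in> {x. measure P {x..} = 0}"
    moreover have "emeasure P ({x. measure P {x..} = 0} \<inter> {x..}) \<le> emeasure P {x..}"
      by (intro emeasure_mono) auto
    ultimately show "emeasure P ({x. measure P {x..} = 0} \<inter> {x..}) = 0"
      by (simp add: P.emeasure_eq_measure)
  qed auto
  ultimately have "{x. measure P {..x} = 0} \<in> null_sets P" "{x. measure P {x..} = 0} \<in> null_sets P"
    by (auto intro!: null_setsI)
  from this[THEN AE_not_in] show ?thesis
    by eventually_elim (auto simp: supp_range_def zero_less_measure_iff)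
qed

text \<open>The cross inequality for \<open>K x\<close> and \<open>K y\<close> with
  \<open>x < y\<close> is integrated over \<open>A1\<close> and \<open>A2\<close>, whose separation
  supplies \<open>x < y\<close>.\<close>

lemma lr_ineq_if_kernel:
  assumes K: "K \<in> borel \<rightarrow>\<^sub>M prob_algebra borel"
    and disint: "\<And>A B. A \<in> sets borel \<Longrightarrow> B \<in> sets borel \<Longrightarrow> emeasure R (A \<times> B) = (\<integral>\<^sup>+x\<in>A. emeasure (K x) B \<partial>P)"
    and lr: "\<And>x1 x2. x1 \<in> supp_range \<Longrightarrow> x2 \<in> supp_range \<Longrightarrow> x1 < x2 \<Longrightarrow> K x1 \<le>\<^sub>l\<^sub>r K x2"
    and A: "A1 \<in> sets borel" "A2 \<in> sets borel" "set_less A1 A2"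
    and B: "B1 \<in> sets borel" "B2 \<in> sets borel" "set_less B1 B2"
  shows "lr_ineq R A1 A2 B1 B2"
proof -
  have [measurable]: "(\<lambda>x. emeasure (K x) B) \<in> borel_measurable borel" if "B \<in> sets borel" for B
    using measurable_compose[OF measurable_prob_algebraD[OF K] measurable_emeasure_subprob_algebra[OF that]] .
  have "emeasure R (A1 \<times> B2) * emeasure R (A2 \<times> B1) \<le> emeasure R (A1 \<times> B1) * emeasure R (A2 \<times> B2)"
    unfolding disint[OF A(1) B(1)] disint[OF A(1) B(2)] disint[OF A(2) B(1)] disint[OF A(2) B(2)]
  proof (rule nn_set_integral_prod_mono[OF _ _ _ _ _ _ AE_supp_range])
    fix x y assume "x \<in> A1" "y \<in> A2" "x \<in> supp_range" "y \<in> supp_range"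
    moreover from this have "x < y" using A(3) by (auto simp: set_less_def)
    ultimately show "emeasure (K x) B2 * emeasure (K y) B1 \<le> emeasure (K x) B1 * emeasure (K y) B2"
      by (intro lr_le_cross_ineq lr B)
  qed (use A B in auto)
  then show ?thesis
    by (simp add: lr_ineq_def emeasure_eq_measure ennreal_mult[symmetric])
qed

end

section \<open>The conditional kernel\<close>

lemma mono_density_mono:
  assumes "\<And>A. A \<in> sets borel \<Longrightarrow> measure Q A \<le> measure Q' A"
  shows "mono_density P Q x \<le> mono_density P Q' x"
proof (rule mono_density_greatest[OF mono_density_le_1])
  fix A assume A: "A \<in> sets borel" "A \<subseteq> {..x}" "0 < measure P A"
  then have "mono_density P Q x \<le> measure Q A / measure P A" by (rule mono_density_le)
  also have "\<dots> \<le> measure Q' A / measure P A"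
    using assms[OF A(1)] by (intro divide_right_mono) auto
  finally show "mono_density P Q x \<le> measure Q' A / measure P A" .
qed

locale tp2_plane = prob_plane R for R +
  assumes tp2: "A1 \<in> sets borel \<Longrightarrow> A2 \<in> sets borel \<Longrightarrow> B1 \<in> sets borel \<Longrightarrow> B2 \<in> sets borel \<Longrightarrow>
    set_less A1 A2 \<Longrightarrow> set_less B1 B2 \<Longrightarrow> lr_ineq R A1 A2 B1 B2"
begin

definition "cond_cdf x y = mono_density P (fst_slice R {..y}) x"

text \<open>Left of the range \<open>cond_cdf x\<close> is constantly \<open>1\<close> and so is no
  distribution function. An arbitrary point mass keeps the kernel a probability measure off the
  range.\<close>

definition "cond_kernel x = (if x \<in> supp_range then interval_measure (cond_cdf x) else return borel 0)"

lemma measure_P: "A \<in> sets borel \<Longrightarrow> measure P A = measure R (A \<times> UNIV)"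
  by (simp add: measure_fst_slice)

text \<open>This is \<open>tp2\<close> with the second coordinate cut into \<open>{..y}\<close> and
  \<open>{y<..}\<close>; the term with both sets over \<open>{..y}\<close> is added to each
  side.\<close>

lemma mono_ratio_slice: "mono_ratio P (fst_slice R {..y})"
proof (intro mono_ratio.intro mono_ratio_axioms.intro finite_borel_measure_fst_slice P.finite_borel_measure_axioms)
  fix A :: "real set" assume [measurable]: "A \<in> sets borel"
  have split: "measure R (A \<times> UNIV) = measure R (A \<times> {..y}) + measure R (A \<times> {y<..})"
    if [measurable]: "A \<in> sets borel" for A :: "real set"
  proof -
    have "A \<times> UNIV = A \<times> {..y} \<union> A \<times> {y<..}" by auto
    then show ?thesis
      by (simp only:) (intro finite_measure_Union; auto simp: sets_R)
  qed
  show "measure (fst_slice R {..y}) A \<le> measure P A"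
    by (simp add: measure_fst_slice split)
  fix B :: "real set" assume [measurable]: "B \<in> sets borel" and "set_less A B"
  then have "lr_ineq R A B {..y} {y<..}"
    by (intro tp2) (auto simp: set_less_def)
  then show "measure (fst_slice R {..y}) B * measure P A \<le> measure (fst_slice R {..y}) A * measure P B"
    by (simp add: measure_fst_slice split lr_ineq_def algebra_simps)
qed auto

section \<open>The infimum as a conditional distribution function\<close>

lemma cond_cdf_mono: "y \<le> z \<Longrightarrow> cond_cdf x y \<le> cond_cdf x z"
  unfolding cond_cdf_def
  by (intro mono_density_mono) (auto simp: measure_fst_slice sets_R intro!: finite_measure_mono)

lemma cond_cdf_le:
  assumes "A \<in> sets borel" "A \<subseteq> {..x}" "0 < measure P A"
  shows "cond_cdf x y \<le> cdf (snd_slice R A) y / measure P A"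
  using mono_density_le[OF assms, of "fst_slice R {..y}"] assms
  by (simp add: cond_cdf_def measure_fst_slice measure_snd_slice cdf_def2)

text \<open>Monotonicity bounds the right limit from below. From above, one set \<open>A\<close>
  with ratio below \<open>r\<close> at \<open>y\<close> gives a right-continuous majorant.\<close>

lemma cond_cdf_right_cont: "continuous (at_right y) (cond_cdf x)"
  unfolding continuous_within
proof (rule order_tendstoI)
  fix r assume r: "r < cond_cdf x y"
  show "\<forall>\<^sub>F z in at_right y. r < cond_cdf x z"
    using eventually_at_right_less
  proof eventually_elim
    case (elim z)
    with r cond_cdf_mono[of y z x] show ?case by simp
  qed
next
  fix r assume "cond_cdf x y < r"
  then show "\<forall>\<^sub>F z in at_right y. cond_cdf x z < r"
    unfolding cond_cdf_def[of x y]
  proof (cases rule: mono_density_lessE)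
    case 1
    then show ?thesis
      by (intro always_eventually allI) (auto simp: cond_cdf_def intro: le_less_trans[OF mono_density_le_1])
  next
    case (2 A)
    interpret S: finite_borel_measure "snd_slice R A"
      by (rule finite_borel_measure_snd_slice) fact
    have "((\<lambda>z. cdf (snd_slice R A) z / measure P A) \<longlongrightarrow> cdf (snd_slice R A) y / measure P A) (at_right y)"
      using S.cdf_is_right_cont[of y] 2 by (intro tendsto_divide) (auto simp: continuous_within)
    moreover have "cdf (snd_slice R A) y / measure P A < r"
      using 2 by (simp add: measure_fst_slice measure_snd_slice cdf_def2)
    ultimately have "\<forall>\<^sub>F z in at_right y. cdf (snd_slice R A) z / measure P A < r"
      by (rule order_tendstoD(2))
    then show ?thesis
      by eventually_elim (use cond_cdf_le[OF 2(1-3)] in \<open>auto intro: le_less_trans\<close>)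
  qed
qed

text \<open>The ratio over \<open>{..x}\<close> competes in the infimum and tends to
  \<open>0\<close>.\<close>

lemma cond_cdf_at_bot:
  assumes "x \<in> supp_range"
  shows "(cond_cdf x \<longlongrightarrow> 0) at_bot"
proof -
  interpret S: finite_borel_measure "snd_slice R {..x}"
    by (rule finite_borel_measure_snd_slice) simp
  have pos: "0 < measure P {..x}" using assms by (simp add: supp_range_def)
  show ?thesis
  proof (rule tendsto_sandwich[where f="\<lambda>_. 0" and h="\<lambda>y. cdf (snd_slice R {..x}) y / measure P {..x}"])
    show "((\<lambda>y. cdf (snd_slice R {..x}) y / measure P {..x}) \<longlongrightarrow> 0) at_bot"
      using tendsto_divide[OF S.cdf_lim_at_bot tendsto_const] pos by simp
    show "\<forall>\<^sub>F y in at_bot. cond_cdf x y \<le> cdf (snd_slice R {..x}) y / measure P {..x}"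
      using pos by (intro always_eventually allI cond_cdf_le) auto
  qed (auto simp: cond_cdf_def mono_density_nonneg)
qed

text \<open>By \<open>cross_weak\<close> the ratio over \<open>{x..}\<close> is at most the ratio
  over every competitor inside \<open>{..x}\<close>, hence a lower bound of the infimum; it tends to
  \<open>1\<close>.\<close>

lemma cond_cdf_at_top:
  assumes "x \<in> supp_range"
  shows "(cond_cdf x \<longlongrightarrow> 1) at_top"
proof -
  interpret S: finite_borel_measure "snd_slice R {x..}"
    by (rule finite_borel_measure_snd_slice) simp
  have pos: "0 < measure P {x..}" using assms by (simp add: supp_range_def)
  have total: "measure (snd_slice R {x..}) (space (snd_slice R {x..})) = measure P {x..}"
    by (simp add: S.borel_UNIV measure_snd_slice measure_P)
  show ?thesis
  proof (rule tendsto_sandwich[where f="\<lambda>y. cdf (snd_slice R {x..}) y / measure P {x..}" and h="\<lambda>_. 1"])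
    show "((\<lambda>y. cdf (snd_slice R {x..}) y / measure P {x..}) \<longlongrightarrow> 1) at_top"
      using tendsto_divide[OF S.cdf_lim_at_top tendsto_const[of "measure P {x..}"]] pos
      by (simp add: total)
    have "cdf (snd_slice R {x..}) y / measure P {x..} \<le> cond_cdf x y" for y
      unfolding cond_cdf_def
    proof (rule mono_density_greatest)
      interpret mono_ratio P "fst_slice R {..y}" by (rule mono_ratio_slice)
      have eq: "cdf (snd_slice R {x..}) y = measure (fst_slice R {..y}) {x..}"
        by (simp add: cdf_def2 measure_fst_slice measure_snd_slice)
      show "cdf (snd_slice R {x..}) y / measure P {x..} \<le> 1"
        using le[of "{x..}"] pos by (simp add: eq)
      fix A assume A: "A \<in> sets borel" "A \<subseteq> {..x}" "0 < measure P A"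
      then show "cdf (snd_slice R {x..}) y / measure P {x..} \<le> measure (fst_slice R {..y}) A / measure P A"
        using cross_weak[OF A(1,2), of "{x..}"] pos by (simp add: eq field_simps)
    qed
    then show "\<forall>\<^sub>F y in at_top. cdf (snd_slice R {x..}) y / measure P {x..} \<le> cond_cdf x y" by simp
  qed (auto simp: cond_cdf_def mono_density_le_1)
qed

section \<open>The kernel and its disintegration of the law\<close>

lemma real_distribution_cond_kernel: "real_distribution (cond_kernel x)"
proof (cases "x \<in> supp_range")
  case True
  then show ?thesis
    unfolding cond_kernel_def
    by (simp add: real_distribution_interval_measure cond_cdf_mono cond_cdf_right_cont cond_cdf_at_bot cond_cdf_at_top)
next
  case False
  then show ?thesis
    by (auto simp: cond_kernel_def real_distribution_def real_distribution_axioms_def prob_space_return)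
qed

lemma cdf_cond_kernel: "x \<in> supp_range \<Longrightarrow> cdf (cond_kernel x) = cond_cdf x"
  unfolding cond_kernel_def
  by (simp add: cdf_interval_measure cond_cdf_mono cond_cdf_right_cont cond_cdf_at_bot)

lemma emeasure_cond_kernel_atMost: "x \<in> supp_range \<Longrightarrow> emeasure (cond_kernel x) {..y} = ennreal (cond_cdf x y)"
  using fun_cong[OF cdf_cond_kernel, of x y] real_distribution_cond_kernel[of x]
  by (simp add: cdf_def2 real_distribution_def prob_space_def finite_measure.emeasure_eq_measure)

text \<open>The rays \<open>{..y}\<close> generate the Borel sets and are stable under intersection;
  on them the kernel is nonincreasing in \<open>x\<close> over the range and constant off
  it.\<close>

lemma measurable_cond_kernel: "cond_kernel \<in> borel \<rightarrow>\<^sub>M prob_algebra borel"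
proof (rule measurable_prob_algebra_generated[where \<Omega>=UNIV and G="range atMost"])
  show "sets borel = sigma_sets UNIV (range (atMost :: real \<Rightarrow> _))"
    by (subst borel_eq_atMost) (simp add: full_SetCompr_eq)
  show "Int_stable (range (atMost :: real \<Rightarrow> _))"
    by (auto simp: Int_stable_def)
  fix x show "prob_space (cond_kernel x)" "sets (cond_kernel x) = sets borel"
    using real_distribution_cond_kernel[of x] by (auto simp: real_distribution_def real_distribution_axioms_def)
next
  fix A :: "real set" assume "A \<in> range atMost"
  then obtain y where A: "A = {..y}" by auto
  have [measurable]: "(\<lambda>x. cond_cdf x y) \<in> borel_measurable borel"
    unfolding cond_cdf_def by measurable
  have "emeasure (cond_kernel x) A =
      (if x \<in> supp_range then ennreal (cond_cdf x y) else indicator {..y} 0)" for x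
    using emeasure_cond_kernel_atMost[of x y] by (auto simp: A cond_kernel_def)
  then show "(\<lambda>x. emeasure (cond_kernel x) A) \<in> borel_measurable borel"
    by simp
qed simp

text \<open>For fixed \<open>A\<close> both sides are finite measures in \<open>B\<close>. On rays
  they agree by \<open>density_eq\<close>, and distribution functions determine such
  measures.\<close>

lemma disintegration:
  assumes A [measurable]: "A \<in> sets borel" and B: "B \<in> sets borel"
  shows "emeasure R (A \<times> B) = (\<integral>\<^sup>+x\<in>A. emeasure (cond_kernel x) B \<partial>P)"
proof -
  \<comment> \<open>The right-hand side as a measure: the mixture of the kernel over
    \<open>P\<close> restricted to \<open>A\<close>.\<close>
  define N where "N = density P (indicator A) \<bind> cond_kernel"
  have K: "cond_kernel \<in> density P (indicator A) \<rightarrow>\<^sub>M subprob_algebra borel"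
    using measurable_prob_algebraD[OF measurable_cond_kernel]
    by (simp cong: measurable_cong_sets)
  have sets_N: "sets N = sets borel"
    unfolding N_def by (rule sets_bind[OF sets_kernel[OF K]]) auto
  have [measurable]: "(\<lambda>x. emeasure (cond_kernel x) C) \<in> borel_measurable borel" if "C \<in> sets borel" for C
    using measurable_compose[OF measurable_prob_algebraD[OF measurable_cond_kernel]
        measurable_emeasure_subprob_algebra[OF that]] .
  have em_N: "emeasure N C = (\<integral>\<^sup>+x\<in>A. emeasure (cond_kernel x) C \<partial>P)" if C [measurable]: "C \<in> sets borel" for C
    unfolding N_def using K
    by (subst emeasure_bind[where N=borel])
      (auto simp: nn_integral_density mult.commute)
  have atMost: "emeasure N {..y} = emeasure R (A \<times> {..y})" for y
  proof -
    interpret mono_ratio P "fst_slice R {..y}" by (rule mono_ratio_slice)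
    have "emeasure N {..y} = (\<integral>\<^sup>+x\<in>A. ennreal (cond_cdf x y) \<partial>P)"
      unfolding em_N[OF atMost_borel]
      using AE_supp_range
      by (intro nn_integral_cong_AE, eventually_elim) (simp add: emeasure_cond_kernel_atMost)
    also have "\<dots> = emeasure (density P (\<lambda>x. ennreal (cond_cdf x y))) A"
      unfolding cond_cdf_def by (simp add: emeasure_density)
    also have "\<dots> = emeasure (fst_slice R {..y}) A"
      unfolding cond_cdf_def density_eq[symmetric] ..
    finally show ?thesis by (simp add: emeasure_fst_slice)
  qed
  have "snd_slice R A = N"
  proof (rule cdf_unique')
    show "finite_borel_measure (snd_slice R A)" by (rule finite_borel_measure_snd_slice) simp
    have K_le: "emeasure (cond_kernel x) UNIV \<le> 1" for x
    proof -
      interpret K: real_distribution "cond_kernel x" by (rule real_distribution_cond_kernel)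
      show ?thesis by (simp add: K.emeasure_eq_measure)
    qed
    have "emeasure N UNIV = (\<integral>\<^sup>+x\<in>A. emeasure (cond_kernel x) UNIV \<partial>P)"
      by (rule em_N) simp
    also have "\<dots> \<le> (\<integral>\<^sup>+x. 1 \<partial>P)"
      by (intro nn_integral_mono) (auto simp: indicator_def K_le)
    finally have "emeasure N UNIV \<le> 1"
      using P.emeasure_space_1 by simp
    then have "emeasure N (space N) \<noteq> \<infinity>"
      using sets_eq_imp_space_eq[OF sets_N] by (auto simp: top_unique)
    then show "finite_borel_measure N"
      using sets_N by (intro finite_borel_measure.intro finite_borel_measure_axioms.intro finite_measureI)
    show "cdf (snd_slice R A) = cdf N"
    proof
      show "cdf (snd_slice R A) y = cdf N y" for y
        using atMost[of y] by (simp add: cdf_def2 measure_def emeasure_snd_slice)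
    qed
  qed
  then show ?thesis
    using em_N[OF B] B by (simp add: emeasure_snd_slice[symmetric])
qed

text \<open>The limits for \<open>{..b}\<close> and \<open>{..a}\<close> run along the same edge
  intervals and can be subtracted.\<close>

lemma measure_cond_kernel_Ioc:
  assumes x: "x \<in> supp_range" and "a < b"
  shows "(\<lambda>n. measure R (edge_Ioc P x n \<times> {a<..b}) / measure P (edge_Ioc P x n))
    \<longlonglongrightarrow> measure (cond_kernel x) {a<..b}"
proof -
  interpret K: real_distribution "cond_kernel x" by (rule real_distribution_cond_kernel)
  have pos: "0 < measure P {..x}" using x by (simp add: supp_range_def)
  have lim: "(\<lambda>n. measure R (edge_Ioc P x n \<times> {..y}) / measure P (edge_Ioc P x n)) \<longlonglongrightarrow> cond_cdf x y" for y
    using mono_ratio.edge_ratio_tendsto[OF mono_ratio_slice pos, of y]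
    by (simp add: measure_fst_slice cond_cdf_def)
  have "measure R (C \<times> {a<..b}) = measure R (C \<times> {..b}) - measure R (C \<times> {..a})"
    if [measurable]: "C \<in> sets borel" for C :: "real set"
  proof -
    interpret S: finite_borel_measure "snd_slice R C" by (rule finite_borel_measure_snd_slice) simp
    show ?thesis
      using S.cdf_diff_eq[OF \<open>a < b\<close>] by (simp add: cdf_def2 measure_snd_slice)
  qed
  then have "(\<lambda>n. measure R (edge_Ioc P x n \<times> {a<..b}) / measure P (edge_Ioc P x n)) =
     (\<lambda>n. measure R (edge_Ioc P x n \<times> {..b}) / measure P (edge_Ioc P x n)
       - measure R (edge_Ioc P x n \<times> {..a}) / measure P (edge_Ioc P x n))"
    by (simp add: diff_divide_distrib)
  moreover have "measure (cond_kernel x) {a<..b} = cond_cdf x b - cond_cdf x a"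
    using K.cdf_diff_eq[OF \<open>a < b\<close>] by (simp add: cdf_cond_kernel x)
  ultimately show ?thesis using tendsto_diff[OF lim[of b] lim[of a]] by simp
qed

text \<open>If \<open>{x1<..x2}\<close> is null, the two kernel measures coincide. Otherwise the
  edge intervals of \<open>x1\<close> and \<open>x2\<close> are eventually separated, and
  \<open>tp2\<close>, divided by their masses, passes to the limit; \<open>cross_ineq_borel\<close>
  then leads from intervals to Borel sets.\<close>

lemma cond_kernel_lr_le:
  assumes x: "x1 \<in> supp_range" "x2 \<in> supp_range" "x1 < x2"
  shows "cond_kernel x1 \<le>\<^sub>l\<^sub>r cond_kernel x2"
proof (rule lr_leI)
  let ?K1 = "cond_kernel x1" and ?K2 = "cond_kernel x2"
  show fin: "finite_borel_measure ?K1" "finite_borel_measure ?K2"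
    by (rule real_distribution.finite_borel_measure_M[OF real_distribution_cond_kernel])+
  have Ioc: "measure ?K2 {y0<..y1} * measure ?K1 {y1<..y2} \<le> measure ?K1 {y0<..y1} * measure ?K2 {y1<..y2}"
    if y: "y0 < y1" "y1 < y2" for y0 y1 y2
  proof (cases "measure P {x1<..x2} = 0")
    case True
    have "cond_cdf x1 y = cond_cdf x2 y" for y
      unfolding cond_cdf_def
      by (rule mono_ratio.mono_density_eq_on_gap[OF mono_ratio_slice _ True]) (use x in simp)
    then have "cond_cdf x1 = cond_cdf x2" by (rule ext)
    then have "?K1 = ?K2" using x by (simp add: cond_kernel_def)
    then show ?thesis by simp
  next
    case False
    then have gap: "0 < measure P {x1<..x2}" by (simp add: zero_less_measure_iff)
    let ?r = "\<lambda>x a b n. measure R (edge_Ioc P x n \<times> {a<..b}) / measure P (edge_Ioc P x n)"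
    show ?thesis
    proof (rule tendsto_le[OF sequentially_bot])
      show "(\<lambda>n. ?r x1 y0 y1 n * ?r x2 y1 y2 n) \<longlonglongrightarrow> measure ?K1 {y0<..y1} * measure ?K2 {y1<..y2}"
        "(\<lambda>n. ?r x2 y0 y1 n * ?r x1 y1 y2 n) \<longlonglongrightarrow> measure ?K2 {y0<..y1} * measure ?K1 {y1<..y2}"
        by (intro tendsto_mult measure_cond_kernel_Ioc x y)+
      show "\<forall>\<^sub>F n in sequentially. ?r x2 y0 y1 n * ?r x1 y1 y2 n \<le> ?r x1 y0 y1 n * ?r x2 y1 y2 n"
        using P.eventually_edge_Ioc_subset[OF x(3) gap]
      proof eventually_elim
        case (elim n)
        have "set_less (edge_Ioc P x1 n) (edge_Ioc P x2 n)"
          using elim edge_Ioc_subset[of P x1 n] by (force simp: set_less_def)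
        then have "lr_ineq R (edge_Ioc P x1 n) (edge_Ioc P x2 n) {y0<..y1} {y1<..y2}"
          by (intro tp2) (auto simp: set_less_def)
        then have "measure R (edge_Ioc P x1 n \<times> {y1<..y2}) * measure R (edge_Ioc P x2 n \<times> {y0<..y1})
              / (measure P (edge_Ioc P x1 n) * measure P (edge_Ioc P x2 n))
            \<le> measure R (edge_Ioc P x1 n \<times> {y0<..y1}) * measure R (edge_Ioc P x2 n \<times> {y1<..y2})
              / (measure P (edge_Ioc P x1 n) * measure P (edge_Ioc P x2 n))"
          unfolding lr_ineq_def by (rule divide_right_mono) simp
        then show ?case by (simp add: ac_simps)
      qed
    qed
  qed
  fix A B :: "real set" assume "A \<in> sets borel" "B \<in> sets borel" "set_less A B"
  from cross_ineq_borel[OF fin closure_UNIV Ioc this]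
  show "measure ?K1 B * measure ?K2 A \<le> measure ?K1 A * measure ?K2 B"
    by (simp add: mult.commute)
qed

end

section \<open>Equivalence of the three conditions for a pair of random variables\<close>

theorem theorem13:
  fixes M :: "'a measure" and X Y :: "'a \<Rightarrow> real" and R :: "(real \<times> real) measure"
  assumes "prob_space M"
    and "X \<in> borel_measurable M" and "Y \<in> borel_measurable M"
    and "R = joint_law M X Y"
  shows
    "((\<forall>A1\<in>sets borel. \<forall>A2\<in>sets borel. \<forall>B1\<in>sets borel. \<forall>B2\<in>sets borel.
         set_less A1 A2 \<longrightarrow> set_less B1 B2 \<longrightarrow> lr_ineq R A1 A2 B1 B2)
      \<longleftrightarrow>
      (\<exists>D :: real set. closure D = UNIV \<and>
         (\<forall>x0\<in>D. \<forall>x1\<in>D. \<forall>x2\<in>D. \<forall>y0\<in>D. \<forall>y1\<in>D. \<forall>y2\<in>D.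
            x0 < x1 \<longrightarrow> x1 < x2 \<longrightarrow> y0 < y1 \<longrightarrow> y1 < y2 \<longrightarrow>
            lr_ineq R {x0<..x1} {x1<..x2} {y0<..y1} {y1<..y2})))
     \<and>
     ((\<forall>A1\<in>sets borel. \<forall>A2\<in>sets borel. \<forall>B1\<in>sets borel. \<forall>B2\<in>sets borel.
         set_less A1 A2 \<longrightarrow> set_less B1 B2 \<longrightarrow> lr_ineq R A1 A2 B1 B2)
      \<longleftrightarrow>
      (\<exists>K. conditional_kernel M X Y K \<and>
         (\<forall>x1\<in>rv_range M X. \<forall>x2\<in>rv_range M X. x1 < x2 \<longrightarrow> K x1 \<le>\<^sub>l\<^sub>r K x2)))"
    (is "(?i \<longleftrightarrow> ?ii) \<and> (?i \<longleftrightarrow> ?iii)")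
proof -
  interpret M: prob_space M by fact
  note [measurable] = assms(2,3)
  have R: "R = distr M (borel \<Otimes>\<^sub>M borel) (\<lambda>\<omega>. (X \<omega>, Y \<omega>))"
    using assms(4) by (simp add: joint_law_def)
  interpret prob_plane R
    unfolding R by (intro prob_plane.intro prob_plane_axioms.intro M.prob_space_distr) auto
  have P: "distr M borel X = P"
  proof (rule measure_eqI)
    fix A assume "A \<in> sets (distr M borel X)"
    then have [measurable]: "A \<in> sets borel" by simp
    have "emeasure R (A \<times> UNIV) = emeasure M ((\<lambda>\<omega>. (X \<omega>, Y \<omega>)) -` (A \<times> UNIV) \<inter> space M)"
      unfolding R by (intro emeasure_distr) auto
    also have "(\<lambda>\<omega>. (X \<omega>, Y \<omega>)) -` (A \<times> UNIV) \<inter> space M = X -` A \<inter> space M" by auto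
    finally show "emeasure (distr M borel X) A = emeasure P A"
      by (simp add: emeasure_fst_slice emeasure_distr)
  qed simp
  have range: "rv_range M X = supp_range"
  proof -
    have "measure P A = measure M {\<omega> \<in> space M. X \<omega> \<in> A}" if "A \<in> sets borel" for A
      unfolding P[symmetric] using that
      by (subst measure_distr) (auto simp: vimage_def Int_def conj_commute)
    then show ?thesis by (simp add: rv_range_def supp_range_def)
  qed
  have kernel: "conditional_kernel M X Y K \<longleftrightarrow> K \<in> borel \<rightarrow>\<^sub>M prob_algebra borel \<and>
      (\<forall>A\<in>sets borel. \<forall>B\<in>sets borel. emeasure R (A \<times> B) = (\<integral>\<^sup>+x\<in>A. emeasure (K x) B \<partial>P))" for K
    unfolding conditional_kernel_def P assms(4) ..
  have "?i" if "?ii"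
  proof -
    from that obtain D where D: "closure D = UNIV"
      "\<forall>x0\<in>D. \<forall>x1\<in>D. \<forall>x2\<in>D. \<forall>y0\<in>D. \<forall>y1\<in>D. \<forall>y2\<in>D.
        x0 < x1 \<longrightarrow> x1 < x2 \<longrightarrow> y0 < y1 \<longrightarrow> y1 < y2 \<longrightarrow> lr_ineq R {x0<..x1} {x1<..x2} {y0<..y1} {y1<..y2}"
      by (elim exE conjE)
    show "?i"
      by (intro ballI impI lr_ineq_borel_if_Ioc[OF D(1) D(2)[rule_format]])
  qed
  \<comment> \<open>\<open>D\<close> can be the whole line, since adjacent half-open intervals are
    separated.\<close>
  moreover have "?ii" if "?i"
    by (rule exI[of _ UNIV]) (auto simp: set_less_def intro!: that[rule_format])
  moreover have "?i" if "?iii"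
  proof -
    from that obtain K where K: "K \<in> borel \<rightarrow>\<^sub>M prob_algebra borel"
      "\<forall>A\<in>sets borel. \<forall>B\<in>sets borel. emeasure R (A \<times> B) = (\<integral>\<^sup>+x\<in>A. emeasure (K x) B \<partial>P)"
      "\<forall>x1\<in>supp_range. \<forall>x2\<in>supp_range. x1 < x2 \<longrightarrow> K x1 \<le>\<^sub>l\<^sub>r K x2"
      unfolding kernel range by (elim exE conjE)
    show "?i"
      by (intro ballI impI lr_ineq_if_kernel[OF K(1) K(2,3)[rule_format]])
  qed
  moreover have "?iii" if "?i"
  proof -
    interpret tp2_plane R
      by unfold_locales (rule that[rule_format])
    show ?iii
      unfolding kernel range
      by (intro exI[of _ cond_kernel] conjI ballI impI measurable_cond_kernel disintegration cond_kernel_lr_le)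
  qed
  ultimately show ?thesis by (intro conjI iffI)
qed

end
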